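(* Let $n\ge 1$ and let $X\in\mathfrak{u}(n+1)$ have exactly two distinct eigenvalues $\sqrt{-1}\,\mu_1$ and $\sqrt{-1}\,\mu_2$ ($\mu_1,\mu_2\in\mathbb{R}$, arbitrary multiplicities), where $\mu_1$ and $\mu_2$ have different signs, i.e. $\mu_1\mu_2<0$, and different absolute values, $|\mu_1|\neq|\mu_2|$. Then there is a non-Riemannian $U(n+1)$-invariant Randers metric $F$ on $S^{2n+1}=U(n+1)/U(n)$, unique up to multiplication by a positive constant, such that $X$ generates CW-translations of $(S^{2n+1},F)$.
   Context: $S^{2n+1}$ is the unit sphere in $\mathbb{C}^{n+1}$ with the standard linear action of $U(n+1)$; $\mathfrak{u}(n+1)$ is the Lie algebra of skew-Hermitian $(n+1)\times(n+1)$ matrices. A homogeneous metric on $S^{2n+1}=U(n+1)/U(n)$ means a $U(n+1)$-invariant one. A Randers metric is a Finsler metric $F=\alpha+\beta$ where $\alpha$ is (the norm of) a smooth Riemannian metric and $\beta$ is a smooth 1-form whose $\alpha$-length is everywhere less than $1$; it is non-Riemannian if $\beta\neq0$. The (possibly non-symmetric) distance $d(x,y)$ is the infimum of $F$-lengths of piecewise smooth curves from $x$ to $y$. A Clifford-Wolf translation (CW-translation) of a Finsler manifold $(M,F)$ is an isometry $\rho$ of $(M,F)$ such that $x\mapsto d(x,\rho(x))$ is constant. "$X$ generates CW-translations" means that the flow $z\mapsto \exp(tX)z$ of the Killing vector field $z\mapsto Xz$ consists of CW-translations for all sufficiently small $t>0$ (equivalently, this Killing field has constant $F$-length). *)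

theory Defs
  imports "HOL-Analysis.Analysis"
begin

section \<open>Smooth maps\<close>

primrec Ck_on :: "nat \<Rightarrow> 'a::real_normed_vector set \<Rightarrow> ('a \<Rightarrow> 'b::real_normed_vector) \<Rightarrow> bool" where
  "Ck_on 0 U f \<longleftrightarrow> continuous_on U f"
| "Ck_on (Suc k) U f \<longleftrightarrow> (\<forall>x\<in>U. f differentiable (at x)) \<and>
     (\<forall>v. Ck_on k U (\<lambda>x. frechet_derivative f (at x) v))"

text \<open>Smoothness on an arbitrary subset of Euclidean space: local extendability to a map that is
  smooth on an open set. On the sphere this is smoothness in the sense of manifolds; on a compact
  interval it is smoothness up to and including the end points.\<close>

definition smooth_on :: "'a::real_normed_vector set \<Rightarrow> ('a \<Rightarrow> 'b::real_normed_vector) \<Rightarrow> bool" where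
  "smooth_on A f \<longleftrightarrow>
     (\<forall>x\<in>A. \<exists>U h. open U \<and> x \<in> U \<and> (\<forall>k. Ck_on k U h) \<and> (\<forall>y\<in>U \<inter> A. h y = f y))"

section \<open>Riemannian and Randers metrics on the unit sphere\<close>

text \<open>Tensors on the sphere take the base point as first argument; only their values at points of
  the sphere and on vectors tangent there are meaningful. The inner product of
  \<^typ>\<open>complex ^ 'm\<close> is the real part of the standard Hermitian product, so for that type
  \<open>usphere\<close> is the unit sphere of complex space and \<open>tsp x\<close> its real tangent space.\<close>

abbreviation usphere :: "'a::euclidean_space set" where
  "usphere \<equiv> sphere 0 1"

definition tsp :: "'a::euclidean_space \<Rightarrow> 'a set" where
  "tsp x = {v. x \<bullet> v = 0}"

definition smooth_vector_field :: "('a::euclidean_space \<Rightarrow> 'a) \<Rightarrow> bool" where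
  "smooth_vector_field V \<longleftrightarrow> smooth_on usphere V \<and> (\<forall>x\<in>usphere. V x \<in> tsp x)"

definition riemannian_metric :: "('a::euclidean_space \<Rightarrow> 'a \<Rightarrow> 'a \<Rightarrow> real) \<Rightarrow> bool" where
  "riemannian_metric g \<longleftrightarrow>
     (\<forall>x\<in>usphere.
        (\<forall>u\<in>tsp x. \<forall>v\<in>tsp x. g x u v = g x v u) \<and>
        (\<forall>u\<in>tsp x. \<forall>v\<in>tsp x. \<forall>w\<in>tsp x. \<forall>a b.
            g x (a *\<^sub>R u + b *\<^sub>R v) w = a * g x u w + b * g x v w) \<and>
        (\<forall>v\<in>tsp x. v \<noteq> 0 \<longrightarrow> g x v v > 0)) \<and>
     (\<forall>V W. smooth_vector_field V \<longrightarrow> smooth_vector_field W \<longrightarrow>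
        smooth_on usphere (\<lambda>x. g x (V x) (W x)))"

definition smooth_one_form :: "('a::euclidean_space \<Rightarrow> 'a \<Rightarrow> real) \<Rightarrow> bool" where
  "smooth_one_form \<beta> \<longleftrightarrow>
     (\<forall>x\<in>usphere. \<forall>u\<in>tsp x. \<forall>v\<in>tsp x. \<forall>a b.
        \<beta> x (a *\<^sub>R u + b *\<^sub>R v) = a * \<beta> x u + b * \<beta> x v) \<and>
     (\<forall>V. smooth_vector_field V \<longrightarrow> smooth_on usphere (\<lambda>x. \<beta> x (V x)))"

text \<open>The length of the covector \<open>\<beta> x\<close> with respect to \<open>g\<close> (dual norm).\<close>

definition covector_length ::
  "('a::euclidean_space \<Rightarrow> 'a \<Rightarrow> 'a \<Rightarrow> real) \<Rightarrow> ('a \<Rightarrow> 'a \<Rightarrow> real) \<Rightarrow> 'a \<Rightarrow> real" where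
  "covector_length g \<beta> x = (SUP v\<in>{v \<in> tsp x. g x v v \<le> 1}. \<bar>\<beta> x v\<bar>)"

definition randers_pair ::
  "('a::euclidean_space \<Rightarrow> 'a \<Rightarrow> real) \<Rightarrow> ('a \<Rightarrow> 'a \<Rightarrow> 'a \<Rightarrow> real) \<Rightarrow> ('a \<Rightarrow> 'a \<Rightarrow> real) \<Rightarrow> bool" where
  "randers_pair F g \<beta> \<longleftrightarrow> riemannian_metric g \<and> smooth_one_form \<beta> \<and>
     (\<forall>x\<in>usphere. covector_length g \<beta> x < 1) \<and>
     (\<forall>x\<in>usphere. \<forall>v\<in>tsp x. F x v = sqrt (g x v v) + \<beta> x v)"

definition nonriemannian_randers :: "('a::euclidean_space \<Rightarrow> 'a \<Rightarrow> real) \<Rightarrow> bool" where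
  "nonriemannian_randers F \<longleftrightarrow>
     (\<exists>g \<beta>. randers_pair F g \<beta> \<and> (\<exists>x\<in>usphere. \<exists>v\<in>tsp x. \<beta> x v \<noteq> 0))"

section \<open>Distance, isometries and Clifford-Wolf translations\<close>

definition piecewise_smooth_curve :: "(real \<Rightarrow> 'a::real_normed_vector) \<Rightarrow> bool" where
  "piecewise_smooth_curve c \<longleftrightarrow>
     (\<exists>(k::nat) s. s 0 = 0 \<and> s k = 1 \<and>
        (\<forall>i<k. s i < s (Suc i) \<and> smooth_on {s i..s (Suc i)} c))"

text \<open>The derivative may be meaningless at the finitely many break points and at the end points,
  which does not affect the integral.\<close>

definition finsler_length ::
  "('a::euclidean_space \<Rightarrow> 'a \<Rightarrow> real) \<Rightarrow> (real \<Rightarrow> 'a) \<Rightarrow> real" where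
  "finsler_length F c = integral {0..1} (\<lambda>t. F (c t) (vector_derivative c (at t)))"

definition finsler_dist :: "('a::euclidean_space \<Rightarrow> 'a \<Rightarrow> real) \<Rightarrow> 'a \<Rightarrow> 'a \<Rightarrow> real" where
  "finsler_dist F x y =
     (INF c\<in>{c. piecewise_smooth_curve c \<and> c ` {0..1} \<subseteq> usphere \<and> c 0 = x \<and> c 1 = y}.
        finsler_length F c)"

text \<open>Isometries are the diffeomorphisms preserving the metric. The map \<open>D\<close> below is determined
  by \<open>\<rho>\<close> on the tangent space, where it is the differential.\<close>

definition finsler_isometry ::
  "('a::euclidean_space \<Rightarrow> 'a \<Rightarrow> real) \<Rightarrow> ('a \<Rightarrow> 'a) \<Rightarrow> bool" where
  "finsler_isometry F \<rho> \<longleftrightarrow>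
     bij_betw \<rho> usphere usphere \<and> smooth_on usphere \<rho> \<and>
     smooth_on usphere (inv_into usphere \<rho>) \<and>
     (\<forall>x\<in>usphere. \<exists>D. (\<rho> has_derivative D) (at x within usphere) \<and>
        (\<forall>v\<in>tsp x. F (\<rho> x) (D v) = F x v))"

definition CW_translation ::
  "('a::euclidean_space \<Rightarrow> 'a \<Rightarrow> real) \<Rightarrow> ('a \<Rightarrow> 'a) \<Rightarrow> bool" where
  "CW_translation F \<rho> \<longleftrightarrow> finsler_isometry F \<rho> \<and>
     (\<exists>r. \<forall>x\<in>usphere. finsler_dist F x (\<rho> x) = r)"

section \<open>The unitary group and its Lie algebra\<close>

definition conj_transpose :: "complex ^ 'm ^ 'm \<Rightarrow> complex ^ 'm ^ 'm" where
  "conj_transpose A = map_matrix cnj (transpose A)"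

definition unitary :: "complex ^ 'm ^ 'm \<Rightarrow> bool" where
  "unitary U \<longleftrightarrow> conj_transpose U ** U = mat 1 \<and> U ** conj_transpose U = mat 1"

definition skew_hermitian :: "complex ^ 'm ^ 'm \<Rightarrow> bool" where
  "skew_hermitian X \<longleftrightarrow> conj_transpose X = - X"

definition eigenvalues :: "complex ^ 'm ^ 'm \<Rightarrow> complex set" where
  "eigenvalues X = {c. \<exists>v. v \<noteq> 0 \<and> X *v v = c *s v}"

text \<open>The multiplication of the type class instance for \<^typ>\<open>'a ^ 'm\<close> is componentwise, so the
  library's powers and exponential are not those of matrices.\<close>

definition matrix_exp :: "complex ^ 'm ^ 'm \<Rightarrow> complex ^ 'm ^ 'm" where
  "matrix_exp A = (\<Sum>k. (1 / fact k) *\<^sub>R (((**) A ^^ k) (mat 1)))"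

definition unitary_invariant :: "(complex ^ 'm \<Rightarrow> complex ^ 'm \<Rightarrow> real) \<Rightarrow> bool" where
  "unitary_invariant F \<longleftrightarrow>
     (\<forall>U. unitary U \<longrightarrow> (\<forall>x\<in>usphere. \<forall>v\<in>tsp x. F (U *v x) (U *v v) = F x v))"

definition generates_CW_translations ::
  "(complex ^ 'm \<Rightarrow> complex ^ 'm \<Rightarrow> real) \<Rightarrow> complex ^ 'm ^ 'm \<Rightarrow> bool" where
  "generates_CW_translations F X \<longleftrightarrow>
     (\<forall>\<^sub>F t in at_right 0. CW_translation F (\<lambda>z. matrix_exp (t *\<^sub>R X) *v z))"

end

theory Submission
  imports Defs
begin

text \<open>Transitivity of the unitary group on pairs of Hermitian-orthogonal vectors forces an invariant
  Randers metric into the form \<open>F x v = sqrt (a \<bar>v\<bar>\<^sup>2 + b s\<^sup>2) + c s\<close> with \<open>s = \<langle>i x, v\<rangle>\<close>. Since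
  \<open>X\<^sup>2 = i (\<mu>1 + \<mu>2) X + \<mu>1 \<mu>2\<close>, along the Killing field \<open>v = X x\<close> one has
  \<open>\<bar>v\<bar>\<^sup>2 = (\<mu>1 + \<mu>2) s - \<mu>1 \<mu>2\<close>. So \<open>F\<close> takes the constant value \<open>k\<close> there iff
  \<open>a ((\<mu>1 + \<mu>2) s - \<mu>1 \<mu>2) + b s\<^sup>2 = (k - c s)\<^sup>2\<close> for all \<open>s\<close>, which determines \<open>b = c\<^sup>2\<close>, \<open>k\<close> and \<open>c\<close>
  from \<open>a\<close>.

  Constant displacement of the flow implies constant \<open>F\<close>-length because the displacement divided by
  the time tends to the \<open>F\<close>-length of the field. Conversely, for \<open>a = 1\<close> and \<open>b = c\<^sup>2\<close> the metric is
  the round one deformed by a multiple of the Hopf field as wind. In the frame moving with the wind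
  the orbits of the flow are great circles, so they are minimizing for small times.\<close>

section \<open>Smooth maps and piecewise smooth curves\<close>

text \<open>In the moving frame minimality is not immediate. The frame is timed by the length of the
  curve, so a competitor shorter than the orbit by \<open>\<epsilon>\<close> is compared with a
  target point turned by a different angle. The saving is worth
  \<open>sqrt (1 + c\<^sup>2) * \<epsilon>\<close> of round length, while the target has moved by at
  most \<open>\<bar>c\<bar> * \<epsilon>\<close>; the strict inequality between the two factors
  decides. For an arbitrary invariant metric \<open>b = c\<^sup>2\<close> is not known beforehand
  and no such frame is at hand. Its displacement is therefore estimated for all admissible
  coefficients, by a linear functional that supports \<open>F\<close> at the starting point. The
  identity in \<open>s\<close> is then tested at three values only: \<open>\<mu>1\<close> and
  \<open>\<mu>2\<close>, taken at unit eigenvectors, and their mean, taken at the normalized sum of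
  these. The two conditions on the eigenvalues act separately: opposite signs make \<open>k\<close>
  real and positive, different absolute values make the one-form nonzero.\<close>

lemma Ck_on_cong:
  assumes "open U" "\<And>x. x \<in> U \<Longrightarrow> f x = g x"
  shows "Ck_on k U f \<longleftrightarrow> Ck_on k U g"
  using assms(2)
proof (induction k arbitrary: f g)
  case 0
  then show ?case by (auto intro: continuous_on_cong)
next
  case (Suc k)
  have ev: "\<forall>\<^sub>F y in nhds x. f y = g y" if "x \<in> U" for x
    using eventually_nhds_in_open[OF \<open>open U\<close> that] Suc.prems by (auto elim: eventually_mono)
  have hd: "(f has_derivative D) (at x) \<longleftrightarrow> (g has_derivative D) (at x)" if "x \<in> U" for x D
    using that Suc.prems \<open>open U\<close>
    by (metis has_derivative_transform_within_open)
  have "Ck_on k U (\<lambda>x. frechet_derivative f (at x) v)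
      \<longleftrightarrow> Ck_on k U (\<lambda>x. frechet_derivative g (at x) v)" for v
    by (rule Suc.IH) (simp add: frechet_derivative_def hd)
  then show ?case by (auto simp: differentiable_def hd)
qed

lemma Ck_on_mono: "Ck_on (Suc k) U f \<Longrightarrow> Ck_on k U f"
proof (induction k arbitrary: f)
  case 0
  then show ?case
    by (auto intro!: continuous_at_imp_continuous_on differentiable_imp_continuous_within)
next
  case (Suc k)
  then show ?case by simp
qed

text \<open>Derivatives at a point are unique, so an explicit \<open>D\<close> may replace the
  choice hidden in \<open>frechet_derivative\<close>. The order-raising steps below go through this
  rule.\<close>

lemma Ck_on_SucI:
  assumes "open U" "\<And>x. x \<in> U \<Longrightarrow> (f has_derivative D x) (at x)"
    and "\<And>v. Ck_on k U (\<lambda>x. D x v)"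
  shows "Ck_on (Suc k) U f"
proof -
  have "frechet_derivative f (at x) = D x" if "x \<in> U" for x
    using assms(2)[OF that] frechet_derivative_at by metis
  then have "Ck_on k U (\<lambda>x. frechet_derivative f (at x) v) \<longleftrightarrow> Ck_on k U (\<lambda>x. D x v)" for v
    by (intro Ck_on_cong[OF \<open>open U\<close>]) simp
  then show ?thesis using assms by (auto simp: differentiable_def)
qed

lemma Ck_on_SucD:
  assumes "Ck_on (Suc k) U f" "x \<in> U"
  shows "(f has_derivative frechet_derivative f (at x)) (at x)"
  using assms frechet_derivative_works by auto

lemma Ck_on_const [simp]: "open U \<Longrightarrow> Ck_on k U (\<lambda>x. a)"
  by (induction k arbitrary: a) (auto simp del: Ck_on.simps(2) intro!: Ck_on_SucI derivative_eq_intros)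

lemma Ck_on_add:
  assumes "open U" "Ck_on k U f" "Ck_on k U g"
  shows "Ck_on k U (\<lambda>x. f x + g x)"
  using assms(2,3)
proof (induction k arbitrary: f g)
  case 0
  then show ?case by (auto intro: continuous_intros)
next
  case (Suc k)
  show ?case
  proof (rule Ck_on_SucI[OF \<open>open U\<close>])
    show "((\<lambda>x. f x + g x) has_derivative
        (\<lambda>v. frechet_derivative f (at x) v + frechet_derivative g (at x) v)) (at x)" if "x \<in> U" for x
      by (intro has_derivative_add Ck_on_SucD[OF Suc.prems(1) that] Ck_on_SucD[OF Suc.prems(2) that])
  qed (use Suc in auto)
qed

text \<open>Induction by the product rule. In each summand one factor stays undifferentiated, and
  \<open>Ck_on_mono\<close> lowers it to the order of the other.\<close>

lemma Ck_on_bilinear: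
  assumes "bounded_bilinear B" "open U" "Ck_on k U f" "Ck_on k U g"
  shows "Ck_on k U (\<lambda>x. B (f x) (g x))"
  using assms(3,4)
proof (induction k arbitrary: f g)
  case 0
  then show ?case by (auto intro: bounded_bilinear.continuous_on[OF assms(1)])
next
  case (Suc k)
  show ?case
  proof (rule Ck_on_SucI[OF \<open>open U\<close>])
    show "((\<lambda>x. B (f x) (g x)) has_derivative
        (\<lambda>v. B (f x) (frechet_derivative g (at x) v) + B (frechet_derivative f (at x) v) (g x))) (at x)"
      if "x \<in> U" for x
      by (intro bounded_bilinear.FDERIV[OF assms(1)] Ck_on_SucD[OF Suc.prems(1) that]
          Ck_on_SucD[OF Suc.prems(2) that])
    show "Ck_on k U (\<lambda>x. B (f x) (frechet_derivative g (at x) v)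
        + B (frechet_derivative f (at x) v) (g x))" for v
      using Suc.prems Ck_on_mono[OF Suc.prems(1)] Ck_on_mono[OF Suc.prems(2)]
      by (intro Ck_on_add \<open>open U\<close> Suc.IH) auto
  qed
qed

lemma Ck_on_bounded_linear:
  assumes "bounded_linear L" "open U" shows "Ck_on k U L"
proof (cases k)
  case 0
  then show ?thesis using assms(1) by (simp add: linear_continuous_on)
next
  case (Suc j)
  show ?thesis unfolding Suc
    by (rule Ck_on_SucI[OF \<open>open U\<close> bounded_linear_imp_has_derivative[OF assms(1)]]) (simp add: assms)
qed

lemma smooth_on_const [simp]: "smooth_on A (\<lambda>x. a)"
  unfolding smooth_on_def by (metis Ck_on_const UNIV_I open_UNIV)

lemma smooth_on_bounded_linear: "bounded_linear L \<Longrightarrow> smooth_on A L"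
  unfolding smooth_on_def by (metis Ck_on_bounded_linear UNIV_I open_UNIV)

lemma smooth_on_cong: "(\<And>x. x \<in> A \<Longrightarrow> f x = g x) \<Longrightarrow> smooth_on A f \<longleftrightarrow> smooth_on A g"
  unfolding smooth_on_def by auto

lemma Ck_on_subset: "Ck_on k U f \<Longrightarrow> V \<subseteq> U \<Longrightarrow> Ck_on k V f"
  by (induction k arbitrary: f) (auto intro: continuous_on_subset)

lemma smooth_on_bilinear:
  assumes B: "bounded_bilinear B" and f: "smooth_on A f" and g: "smooth_on A g"
  shows "smooth_on A (\<lambda>x. B (f x) (g x))"
  unfolding smooth_on_def
proof
  fix x assume "x \<in> A"
  then obtain U h V j where
    U: "open U" "x \<in> U" "\<And>k. Ck_on k U h" "\<And>y. y \<in> U \<inter> A \<Longrightarrow> h y = f y"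
    and V: "open V" "x \<in> V" "\<And>k. Ck_on k V j" "\<And>y. y \<in> V \<inter> A \<Longrightarrow> j y = g y"
    using f g unfolding smooth_on_def by metis
  have "Ck_on k (U \<inter> V) (\<lambda>x. B (h x) (j x))" for k
    by (intro Ck_on_bilinear[OF B] open_Int U V Ck_on_subset[OF U(3)] Ck_on_subset[OF V(3)]) auto
  then show "\<exists>U h. open U \<and> x \<in> U \<and> (\<forall>k. Ck_on k U h) \<and> (\<forall>y\<in>U \<inter> A. h y = B (f y) (g y))"
    using U V by (intro exI[of _ "U \<inter> V"] exI[of _ "\<lambda>x. B (h x) (j x)"]) auto
qed

lemma smooth_on_add:
  assumes f: "smooth_on A f" and g: "smooth_on A g"
  shows "smooth_on A (\<lambda>x. f x + g x)"
  unfolding smooth_on_def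
proof
  fix x assume "x \<in> A"
  then obtain U h V j where
    U: "open U" "x \<in> U" "\<And>k. Ck_on k U h" "\<And>y. y \<in> U \<inter> A \<Longrightarrow> h y = f y"
    and V: "open V" "x \<in> V" "\<And>k. Ck_on k V j" "\<And>y. y \<in> V \<inter> A \<Longrightarrow> j y = g y"
    using f g unfolding smooth_on_def by metis
  have "Ck_on k (U \<inter> V) (\<lambda>x. h x + j x)" for k
    by (intro Ck_on_add open_Int U V Ck_on_subset[OF U(3)] Ck_on_subset[OF V(3)]) auto
  then show "\<exists>U h. open U \<and> x \<in> U \<and> (\<forall>k. Ck_on k U h) \<and> (\<forall>y\<in>U \<inter> A. h y = f y + g y)"
    using U V by (intro exI[of _ "U \<inter> V"] exI[of _ "\<lambda>x. h x + j x"]) auto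
qed

text \<open>The local extensions \<open>h\<close> vary from point to point. The derivative is
  therefore taken within the interval, where it depends on \<open>c\<close> alone and is unique
  because \<open>a < b\<close>; each \<open>h\<close> then yields continuity near its own
  point.\<close>

lemma smooth_on_interval_derivative:
  fixes c :: "real \<Rightarrow> 'a::euclidean_space"
  assumes "smooth_on {a..b} c" "a < b"
  obtains d where "continuous_on {a..b} d"
    and "\<And>t. t \<in> {a..b} \<Longrightarrow> (c has_vector_derivative d t) (at t within {a..b})"
proof -
  define d where "d t = vector_derivative c (at t within {a..b})" for t
  have "(c has_vector_derivative d t) (at t within {a..b}) \<and> continuous (at t within {a..b}) d"
    if t: "t \<in> {a..b}" for t
  proof -
    obtain U h where U: "open U" "t \<in> U" "\<And>k. Ck_on k U h" "\<And>y. y \<in> U \<inter> {a..b} \<Longrightarrow> h y = c y"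
      using assms(1) t unfolding smooth_on_def by metis
    define D where "D y = frechet_derivative h (at y) 1" for y
    have cD: "(c has_vector_derivative D y) (at y within {a..b})" if y: "y \<in> U" "y \<in> {a..b}" for y
    proof -
      have "(h has_derivative frechet_derivative h (at y)) (at y)"
        using Ck_on_SucD[OF U(3) y(1)] .
      moreover have "frechet_derivative h (at y) = (\<lambda>x. x *\<^sub>R D y)"
      proof
        fix r :: real
        have "linear (frechet_derivative h (at y))"
          using calculation has_derivative_linear by blast
        from linear_cmul[OF this, of r 1] show "frechet_derivative h (at y) r = r *\<^sub>R D y"
          by (simp add: D_def)
      qed
      ultimately have "(h has_derivative (\<lambda>x. x *\<^sub>R D y)) (at y)" by simp
      then have "(h has_derivative (\<lambda>x. x *\<^sub>R D y)) (at y within {a..b})"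
        by (rule has_derivative_at_withinI)
      moreover have "\<forall>\<^sub>F z in at y within {a..b}. h z = c z"
        unfolding eventually_at_topological using U(1,4) y by (intro exI[of _ U]) auto
      ultimately have "(c has_derivative (\<lambda>x. x *\<^sub>R D y)) (at y within {a..b})"
        using y U(4) by (intro has_derivative_transform_eventually[of h _ y "{a..b}" c]) auto
      then show ?thesis unfolding has_vector_derivative_def .
    qed
    have dD: "d y = D y" if "y \<in> U" "y \<in> {a..b}" for y
      unfolding d_def using vector_derivative_within_cbox[OF \<open>a < b\<close>] cD that by (metis box_real(2))
    have "continuous_on U D"
      using U(3)[of 1] unfolding D_def by simp
    then have "continuous (at t within {a..b}) D"
      using U(1,2) by (simp add: continuous_on_eq_continuous_at continuous_at_imp_continuous_within)
    moreover have "\<forall>\<^sub>F z in at t within {a..b}. D z = d z"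
      unfolding eventually_at_topological using U(1,2) dD by (intro exI[of _ U]) auto
    ultimately have "continuous (at t within {a..b}) d"
      unfolding continuous_within using dD[OF U(2) t] tendsto_cong by fastforce
    then show ?thesis using cD[OF U(2) t] dD[OF U(2) t] by simp
  qed
  then show ?thesis
    by (intro that[of d]) (auto simp: continuous_on_eq_continuous_within)
qed

text \<open>Collects what all later integrals along curves need. Integrability is stated for every
  continuous function of position and velocity, which covers both \<open>F\<close>-length and
  Euclidean length. The induction appends one smooth piece at a time.\<close>

lemma piecewise_smooth_curveE:
  fixes c :: "real \<Rightarrow> 'a::euclidean_space"
  assumes "piecewise_smooth_curve c"
  obtains K where "finite K" and "continuous_on {0..1} c"
    and "\<And>t. t \<in> {0<..<1} - K \<Longrightarrow> (c has_vector_derivative vector_derivative c (at t)) (at t)"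
    and "\<And>t. t \<in> {0<..<1} - K \<Longrightarrow> isCont (\<lambda>t. vector_derivative c (at t)) t"
    and "\<And>\<Phi>. continuous_on UNIV (\<lambda>(x, v). \<Phi> x v) \<Longrightarrow>
      (\<lambda>t. \<Phi> (c t) (vector_derivative c (at t)) :: real) integrable_on {0..1}"
proof -
  obtain k :: nat and s where s: "s 0 = 0" "s k = 1"
    and sm: "\<And>i. i < k \<Longrightarrow> s i < s (Suc i) \<and> smooth_on {s i..s (Suc i)} c"
    using assms unfolding piecewise_smooth_curve_def by metis
  define K where "K = s ` {..k}"
  define c' where "c' t = vector_derivative c (at t)" for t
  have "0 \<le> s j \<and> continuous_on {0..s j} c
     \<and> (\<forall>t\<in>{0<..<s j} - K. (c has_vector_derivative c' t) (at t) \<and> isCont c' t)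
     \<and> (\<forall>\<Phi>. continuous_on UNIV (\<lambda>(x, v). \<Phi> x v) \<longrightarrow>
           (\<lambda>t. \<Phi> (c t) (c' t) :: real) integrable_on {0..s j})" if "j \<le> k" for j
    using that
  proof (induction j)
    case 0
    then show ?case using integrable_on_refl[of _ "0::real"] by (auto simp add: s)
  next
    case (Suc j)
    then have lt: "s j < s (Suc j)" and sj: "smooth_on {s j..s (Suc j)} c" using sm by auto
    from sj lt obtain d where d: "continuous_on {s j..s (Suc j)} d"
      and cd: "\<And>t. t \<in> {s j..s (Suc j)} \<Longrightarrow> (c has_vector_derivative d t) (at t within {s j..s (Suc j)})"
      by (rule smooth_on_interval_derivative) blast
    have IH: "0 \<le> s j" "continuous_on {0..s j} c"
      "\<And>t. t\<in>{0<..<s j} - K \<Longrightarrow> (c has_vector_derivative c' t) (at t) \<and> isCont c' t"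
      "\<And>\<Phi>. continuous_on UNIV (\<lambda>(x, v). \<Phi> x v) \<Longrightarrow>
           (\<lambda>t. \<Phi> (c t) (c' t) :: real) integrable_on {0..s j}"
      using Suc by auto
    have cc: "continuous_on {s j..s (Suc j)} c"
      unfolding continuous_on_eq_continuous_within
      by (intro ballI has_vector_derivative_continuous[OF cd])
    have un: "{0..s (Suc j)} = {0..s j} \<union> {s j..s (Suc j)}" using IH(1) lt by auto
    have cdt: "(c has_vector_derivative d t) (at t)" if "t \<in> {s j<..<s (Suc j)}" for t
      using cd[of t] that by (simp add: at_within_Icc_at)
    then have dc: "c' t = d t" if "t \<in> {s j<..<s (Suc j)}" for t
      using that vector_derivative_at unfolding c'_def by blast
    have ic: "isCont c' t" if t: "t \<in> {s j<..<s (Suc j)}" for t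
    proof -
      have "isCont d t"
        using t d continuous_on_interior[of "{s j..s (Suc j)}" d t] by simp
      moreover have "\<forall>\<^sub>F z in nhds t. d z = c' z"
        using eventually_nhds_in_open[OF open_greaterThanLessThan t] dc by (auto elim: eventually_mono)
      ultimately show ?thesis using isCont_cong by fast
    qed
    have "(\<lambda>t. \<Phi> (c t) (c' t) :: real) integrable_on {s j..s (Suc j)}"
      if \<Phi>: "continuous_on UNIV (\<lambda>(x, v). \<Phi> x v)" for \<Phi>
    proof -
      \<comment> \<open>The one-sided derivative \<open>d\<close> is continuous up to the ends of
        the piece; the two-sided one can differ from it only at the two end points, which the
        integral ignores.\<close>
      have "continuous_on {s j..s (Suc j)} (\<lambda>t. \<Phi> (c t) (d t))"
        using continuous_on_compose2[OF \<Phi> continuous_on_Pair[OF cc d]] by auto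
      then have "(\<lambda>t. \<Phi> (c t) (d t)) integrable_on {s j..s (Suc j)}"
        by (rule integrable_continuous_real)
      then show ?thesis
        by (rule integrable_spike_finite[of "{s j, s (Suc j)}", rotated 2]) (auto simp: dc)
    qed
    then have "(\<lambda>t. \<Phi> (c t) (c' t) :: real) integrable_on {0..s (Suc j)}"
      if "continuous_on UNIV (\<lambda>(x, v). \<Phi> x v)" for \<Phi>
      using Henstock_Kurzweil_Integration.integrable_combine[OF IH(1) less_imp_le[OF lt] IH(4)[OF that]] that
      by blast
    moreover have "continuous_on {0..s (Suc j)} c"
      unfolding un by (intro continuous_on_closed_Un IH cc) auto
    moreover have "(c has_vector_derivative c' t) (at t) \<and> isCont c' t"
      if t: "t \<in> {0<..<s (Suc j)} - K" for t
    proof -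
      have "t \<noteq> s j" using t Suc.prems unfolding K_def by auto
      then consider "t \<in> {0<..<s j} - K" | "t \<in> {s j<..<s (Suc j)}"
        using t by force
      then show ?thesis using IH(3) cdt ic dc by cases auto
    qed
    ultimately show ?case using IH(1) lt by auto
  qed
  from this[of k] have "continuous_on {0..1} c"
     "(\<forall>t\<in>{0<..<1} - K. (c has_vector_derivative c' t) (at t) \<and> isCont c' t)
     \<and> (\<forall>\<Phi>. continuous_on UNIV (\<lambda>(x, v). \<Phi> x v) \<longrightarrow>
           (\<lambda>t. \<Phi> (c t) (c' t) :: real) integrable_on {0..1})" 
    by (auto simp: s)
  moreover have "finite K" unfolding K_def by simp
  ultimately show ?thesis unfolding c'_def by (intro that[of K]) auto
qed

lemma tangent_curve:
  fixes c :: "real \<Rightarrow> 'a::euclidean_space"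
  assumes "c ` {0..1} \<subseteq> usphere" "t \<in> {0<..<1}" "(c has_vector_derivative v) (at t)"
  shows "v \<in> tsp (c t)"
proof -
  have "((\<lambda>t. c t \<bullet> c t) has_vector_derivative (c t \<bullet> v + v \<bullet> c t)) (at t)"
    by (intro bounded_bilinear.has_vector_derivative[OF bounded_bilinear_inner] assms)
  moreover have "((\<lambda>t. c t \<bullet> c t) has_vector_derivative 0) (at t)"
  proof (rule has_vector_derivative_transform_within_open[OF _ open_greaterThanLessThan assms(2)])
    show "((\<lambda>t. 1::real) has_vector_derivative 0) (at t)" by simp
    show "1 = c y \<bullet> c y" if "y \<in> {0<..<1}" for y
    proof -
      have "c y \<in> c ` {0..1}" using that by auto
      then show ?thesis using assms(1) by (auto simp: power2_norm_eq_inner[symmetric])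
    qed
  qed
  ultimately have "c t \<bullet> v + v \<bullet> c t = 0"
    using vector_derivative_unique_at by blast
  then show ?thesis by (simp add: tsp_def inner_commute)
qed

section \<open>The unitary group\<close>

lemma inner_complex_mult: "(a * b) \<bullet> c = b \<bullet> (cnj a * c)" for a b c :: complex
  by (simp add: inner_complex_def algebra_simps)

lemma inner_smult_left: "(a *s v) \<bullet> w = v \<bullet> (cnj a *s w)" for v w :: "complex ^ 'm"
  by (simp add: inner_vec_def inner_complex_mult)

lemma inner_imult_left: "(\<i> *s v) \<bullet> w = - (v \<bullet> (\<i> *s w))" for v w :: "complex ^ 'm"
  by (simp add: inner_vec_def inner_complex_mult sum_negf)

lemma inner_imult_self [simp]: "(\<i> *s v) \<bullet> v = 0" "v \<bullet> (\<i> *s v) = 0" for v :: "complex ^ 'm"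
  using inner_imult_left[of v v] inner_commute[of v "\<i> *s v"] by linarith+

lemma imult_imult [simp]: "\<i> *s (\<i> *s v) = - v" for v :: "complex ^ 'm"
  by (simp add: vec_eq_iff)

lemma inner_imult_imult [simp]: "(\<i> *s v) \<bullet> (\<i> *s w) = v \<bullet> w" for v w :: "complex ^ 'm"
  by (simp add: inner_imult_left)

lemma scaleR_eq_smult: "r *\<^sub>R v = complex_of_real r *s v" for v :: "complex ^ 'm"
  by (simp add: vec_eq_iff) (simp add: scaleR_conv_of_real)

lemma smult_scaleR: "a *s (r *\<^sub>R v) = r *\<^sub>R (a *s v)" for v :: "complex ^ 'm"
  by (simp add: vec_eq_iff)

lemma norm_smult: "norm (a *s v) = cmod a * norm v" for v :: "complex ^ 'm"
  by (simp add: norm_vec_def norm_mult L2_set_right_distrib)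

lemma bounded_linear_smult: "bounded_linear (\<lambda>v. a *s v)" for a :: complex
  by (rule linear_conv_bounded_linear[THEN iffD1], rule linearI)
    (simp_all add: vec_eq_iff algebra_simps)

lemma bounded_bilinear_smult: "bounded_bilinear (\<lambda>a (v :: complex ^ 'm). a *s v)"
proof
  show "\<exists>K. \<forall>a (b :: complex ^ 'm). norm (a *s b) \<le> norm a * norm b * K"
    by (rule exI[of _ 1]) (simp add: norm_smult)
qed (simp_all add: vec_eq_iff algebra_simps)

lemma bounded_linear_matrix_vector: "bounded_linear (\<lambda>v. A *v v)" for A :: "complex ^ 'm ^ 'm"
  by (rule linear_conv_bounded_linear[THEN iffD1], rule linearI)
    (simp_all add: matrix_vector_mult_add_rdistrib vec_eq_iff matrix_vector_mult_def
      scaleR_sum_right sum.distrib algebra_simps)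

lemma inner_conj_transpose: "(A *v v) \<bullet> w = v \<bullet> (conj_transpose A *v w)"
  for A :: "complex ^ 'm ^ 'm"
proof -
  have "(A *v v) \<bullet> w = (\<Sum>i\<in>UNIV. \<Sum>j\<in>UNIV. v $ j \<bullet> (cnj (A $ i $ j) * w $ i))"
    by (simp add: inner_vec_def matrix_vector_mult_def inner_sum_left inner_complex_mult)
  also have "\<dots> = (\<Sum>j\<in>UNIV. \<Sum>i\<in>UNIV. v $ j \<bullet> (cnj (A $ i $ j) * w $ i))"
    by (rule sum.swap)
  also have "\<dots> = v \<bullet> (conj_transpose A *v w)"
    by (simp add: inner_vec_def matrix_vector_mult_def inner_sum_right conj_transpose_def
        map_matrix_def transpose_def)
  finally show ?thesis .
qed

text \<open>Polarization recovers real inner products from norms, and \<open>conj_transpose\<close>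
  is the adjoint for the real product as well. This gives a left inverse, which for square matrices
  is a right inverse.\<close>

lemma unitaryI:
  fixes U :: "complex ^ 'm ^ 'm"
  assumes "\<And>v. norm (U *v v) = norm v"
  shows "unitary U"
proof -
  have inn: "(U *v v) \<bullet> (U *v w) = v \<bullet> w" for v w
    using assms[of "v + w"] assms[of v] assms[of w]
    by (simp add: dot_norm matrix_vector_right_distrib[symmetric])
  have "conj_transpose U ** U = mat 1"
    unfolding matrix_eq
  proof
    fix v
    have "w \<bullet> ((conj_transpose U ** U) *v v) = w \<bullet> v" for w
      using inn[of w v]
      by (simp add: inner_conj_transpose matrix_vector_mul_assoc[symmetric])
    then show "(conj_transpose U ** U) *v v = mat 1 *v v"
      by (metis inner_diff_right inner_eq_zero_iff matrix_vector_mul_lid right_minus_eq)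
  qed
  then show ?thesis
    by (simp add: unitary_def matrix_left_right_inverse)
qed

lemma unitary_inner:
  assumes "unitary U"
  shows "(U *v v) \<bullet> (U *v w) = v \<bullet> w"
  using assms by (simp add: inner_conj_transpose matrix_vector_mul_assoc unitary_def)

lemma unitary_norm: "unitary U \<Longrightarrow> norm (U *v v) = norm v"
  by (simp add: norm_eq_sqrt_inner unitary_inner)

text \<open>With \<open>u = x - y\<close> and \<open>d = \<langle>u, x\<rangle>\<close>, the map \<open>z \<mapsto> z - u \<langle>u, z\<rangle> / d\<close> sends \<open>x\<close> to \<open>y\<close>.
  It is unitary because \<open>2 Re d = \<bar>u\<bar>\<^sup>2\<close>.\<close>

lemma unitary_transitive:
  fixes x y :: "complex ^ 'm"
  assumes "norm x = norm y"
  obtains U where "unitary U" "U *v x = y"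
    and "\<And>z. z \<bullet> x = 0 \<Longrightarrow> z \<bullet> y = 0 \<Longrightarrow> (\<i> *s z) \<bullet> x = 0 \<Longrightarrow> (\<i> *s z) \<bullet> y = 0 \<Longrightarrow> U *v z = z"
proof (cases "x = y")
  case True
  have "unitary (mat 1 :: complex ^ 'm ^ 'm)" by (rule unitaryI) simp
  then show ?thesis using True by (intro that[of "mat 1"]) auto
next
  case False
  define u where "u = x - y"
  define h where "h v = (\<Sum>i\<in>UNIV. cnj (u $ i) * v $ i)" for v :: "complex ^ 'm"
  have Re_h: "Re (h v) = u \<bullet> v" for v
    by (simp add: h_def inner_vec_def inner_complex_def)
  have Im_h: "Im (h v) = (\<i> *s u) \<bullet> v" for v
    by (simp add: h_def inner_vec_def inner_complex_def algebra_simps)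
  define d where "d = h x"
  \<comment> \<open>Equality of the norms of \<open>x\<close> and \<open>y\<close> enters here only.
    Since \<open>u\<close> is nonzero, it also permits division by \<open>d\<close>.\<close>
  have d2: "2 * Re d = (norm u)\<^sup>2"
    using assms by (simp add: d_def Re_h u_def power2_norm_eq_inner inner_diff norm_eq inner_commute)
  then have d0: "d \<noteq> 0" using False u_def by auto
  define U :: "complex ^ 'm ^ 'm" where "U = (\<chi> i j. (if i = j then 1 else 0) - u $ i * cnj (u $ j) / d)"
  have U: "U *v v = v - (h v / d) *s u" for v
  proof -
    have "(U *v v) $ i = v $ i - (h v / d) * u $ i" for i
    proof -
      have "(U *v v) $ i = (\<Sum>j\<in>UNIV. (if i = j then v $ j else 0) - u $ i / d * (cnj (u $ j) * v $ j))"
        unfolding U_def matrix_vector_mult_def by (auto intro!: sum.cong simp: algebra_simps)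
      also have "\<dots> = v $ i - u $ i / d * h v"
        by (simp add: sum_subtractf h_def sum_distrib_left)
      finally show ?thesis by (simp add: mult.commute)
    qed
    then show ?thesis by (simp add: vec_eq_iff)
  qed
  have Ux: "U *v x = y" using d0 by (simp add: U d_def[symmetric]) (simp add: u_def)
  have "norm (U *v v) = norm v" for v
  proof -
    define q where "q = h v / d"
    have "v \<bullet> (q *s u) = Re (h (cnj q *s v))"
      by (simp add: Re_h inner_commute[of v] inner_smult_left)
    also have "h (cnj q *s v) = cnj q * h v"
      by (simp add: h_def sum_distrib_left algebra_simps)
    also have "\<dots> = (q * cnj q) * d" using d0 by (simp add: q_def)
    also have "\<dots> = of_real ((cmod q)\<^sup>2) * d" by (simp only: complex_norm_square)
    also have "Re \<dots> = (cmod q)\<^sup>2 * Re d" by (simp del: of_real_power)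
    finally have "2 * (v \<bullet> (q *s u)) = (norm (q *s u))\<^sup>2"
      using d2 by (simp add: norm_smult power_mult_distrib algebra_simps)
    then have "(norm (v - q *s u))\<^sup>2 = (norm v)\<^sup>2"
      by (simp add: power2_norm_eq_inner inner_diff inner_commute)
    then show ?thesis by (simp add: U q_def)
  qed
  then have "unitary U" by (rule unitaryI)
  moreover have "U *v z = z"
    if "z \<bullet> x = 0" "z \<bullet> y = 0" "(\<i> *s z) \<bullet> x = 0" "(\<i> *s z) \<bullet> y = 0" for z
  proof -
    have "u \<bullet> z = 0" "(\<i> *s z) \<bullet> u = 0"
      using that by (simp_all add: u_def inner_diff inner_commute[of _ z])
    then have "Re (h z) = 0" "Im (h z) = 0"
      unfolding Re_h Im_h by (simp, metis inner_imult_left inner_commute neg_0_equal_iff_equal)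
    then have "h z = 0" by (simp add: complex_eq_iff)
    then show ?thesis by (simp add: U)
  qed
  ultimately show ?thesis using Ux that by blast
qed

text \<open>One map carries \<open>x\<close> to \<open>y\<close>, a second carries the image of
  \<open>v\<close> to \<open>w\<close>. The second one fixes \<open>y\<close>, because
  \<open>y\<close> is Hermitian-orthogonal to both of these vectors.\<close>

lemma unitary_transitive_frames:
  fixes x v y w :: "complex ^ 'm"
  assumes "norm x = norm y" "norm v = norm w"
    and "x \<bullet> v = 0" "(\<i> *s x) \<bullet> v = 0" "y \<bullet> w = 0" "(\<i> *s y) \<bullet> w = 0"
  obtains U where "unitary U" "U *v x = y" "U *v v = w"
proof -
  obtain U where U: "unitary U" "U *v x = y"
    using unitary_transitive[OF assms(1)] by metis
  have iU: "U *v (\<i> *s x) = \<i> *s y" by (simp add: U vector_scalar_commute)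
  have Uv: "y \<bullet> (U *v v) = 0" "(\<i> *s y) \<bullet> (U *v v) = 0"
    using unitary_inner[OF U(1), of x v] unitary_inner[OF U(1), of "\<i> *s x" v] assms
    by (simp_all add: U iU)
  have n: "norm (U *v v) = norm w" using assms by (simp add: unitary_norm[OF U(1)])
  obtain V where V: "unitary V" "V *v (U *v v) = w" and Vz: "\<And>z. z \<bullet> (U *v v) = 0 \<Longrightarrow> z \<bullet> w = 0 \<Longrightarrow>
      (\<i> *s z) \<bullet> (U *v v) = 0 \<Longrightarrow> (\<i> *s z) \<bullet> w = 0 \<Longrightarrow> V *v z = z"
    using unitary_transitive[OF n] by metis
  have "V *v y = y" using Vz Uv assms by blast
  moreover have "unitary (V ** U)"
    by (rule unitaryI) (simp add: matrix_vector_mul_assoc[symmetric] unitary_norm U V)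
  ultimately show ?thesis
    by (intro that[of "V ** U"]) (simp_all add: matrix_vector_mul_assoc[symmetric] U V)
qed

section \<open>Skew-Hermitian matrices with two eigenvalues\<close>

text \<open>A maximum point \<open>z\<close> of the Rayleigh quotient on the unit sphere of
  \<open>W\<close> is an eigenvector: \<open>B = m - A\<close> is positive semidefinite on
  \<open>W\<close> with \<open>B z \<bullet> z = 0\<close>, and this forces
  \<open>B z = 0\<close>.\<close>

lemma self_adjoint_eigenvector:
  fixes A :: "'a::euclidean_space \<Rightarrow> 'a"
  assumes "linear A" and self_adjoint: "\<And>v w. A v \<bullet> w = v \<bullet> A w"
    and W: "subspace W" "\<And>w. w \<in> W \<Longrightarrow> A w \<in> W" and "W \<noteq> {0}"
  obtains v m where "v \<in> W" "v \<noteq> 0" "A v = m *\<^sub>R v"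
proof -
  interpret A: linear A by fact
  obtain w where w: "w \<in> W" "w \<noteq> 0" using \<open>W \<noteq> {0}\<close> subspace_0[OF W(1)] by auto
  let ?S = "W \<inter> sphere 0 1"
  have "(1 / norm w) *\<^sub>R w \<in> ?S" using w subspace_scale[OF W(1)] by simp
  then have ne: "?S \<noteq> {}" by blast
  have "compact ?S" using closed_subspace[OF W(1)] by (intro closed_Int_compact) auto
  moreover have "continuous_on ?S (\<lambda>v. A v \<bullet> v)"
    by (intro continuous_intros linear_continuous_on_compose[OF _ \<open>linear A\<close>])
  ultimately obtain z where z: "z \<in> ?S" and max: "\<And>v. v \<in> ?S \<Longrightarrow> A v \<bullet> v \<le> A z \<bullet> z"
    using continuous_attains_sup[of ?S "\<lambda>v. A v \<bullet> v"] ne by blast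
  define m where "m = A z \<bullet> z"
  define B where "B v = m *\<^sub>R v - A v" for v
  have B_nonneg: "0 \<le> B v \<bullet> v" if "v \<in> W" for v
  proof (cases "v = 0")
    case False
    have "(1 / norm v) *\<^sub>R v \<in> ?S" using that False subspace_scale[OF W(1)] by simp
    from max[OF this] have "(A v \<bullet> v) / (norm v)\<^sup>2 \<le> m"
      by (simp add: A.scaleR m_def power2_eq_square)
    then show ?thesis
      using False by (simp add: B_def inner_diff field_simps power2_norm_eq_inner)
  qed (simp add: B_def)
  have zz: "z \<bullet> z = 1" using z by (simp add: norm_eq_1)
  have Bz: "B z \<in> W" using z W by (auto simp: B_def intro!: subspace_diff subspace_scale)
  have "B z \<bullet> B z = 0"
  proof (rule ccontr)
    assume "B z \<bullet> B z \<noteq> 0"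
    then have pos: "0 < B z \<bullet> B z" by simp
    define K where "K = B (B z) \<bullet> B z"
    have K: "0 \<le> K" using B_nonneg[OF Bz] by (simp add: K_def)
    have quad: "0 \<le> - 2 * t * (B z \<bullet> B z) + t\<^sup>2 * K" for t
    proof -
      have sa: "B v \<bullet> w = v \<bullet> B w" for v w
        by (simp add: B_def inner_diff_left inner_diff_right self_adjoint)
      have "z - t *\<^sub>R B z \<in> W" using z Bz W by (auto intro!: subspace_diff subspace_scale)
      from B_nonneg[OF this] have "0 \<le> (B z - t *\<^sub>R B (B z)) \<bullet> (z - t *\<^sub>R B z)"
        by (simp add: B_def A.diff A.add A.scaleR algebra_simps)
      also have "\<dots> = B z \<bullet> z - 2 * t * (B z \<bullet> B z) + t\<^sup>2 * K"
        using sa[of "B z" z] by (simp add: inner_diff K_def power2_eq_square algebra_simps)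
      also have "B z \<bullet> z = 0" by (simp add: B_def inner_diff m_def zz)
      finally show ?thesis by simp
    qed
    \<comment> \<open>Moving from \<open>z\<close> by \<open>- t *\<^sub>R B z\<close> makes the
      form negative once the linear term outweighs the quadratic one. The denominator
      \<open>K + 1\<close> achieves this and is positive even if \<open>K = 0\<close>.\<close>
    define t where "t = (B z \<bullet> B z) / (K + 1)"
    have "0 \<le> t * (t * K - 2 * (B z \<bullet> B z))"
      using quad[of t] by (simp add: power2_eq_square algebra_simps)
    moreover have "0 < t" "t * K \<le> B z \<bullet> B z" using K pos by (simp_all add: t_def field_simps)
    ultimately show False using pos by (simp add: zero_le_mult_iff)
  qed
  then have "A z = m *\<^sub>R z" by (simp add: B_def)
  moreover have "z \<noteq> 0" using zz by auto
  ultimately show ?thesis using that[of z m] z by blast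
qed

lemma skew_hermitian_inner:
  assumes "skew_hermitian X"
  shows "(X *v v) \<bullet> w = - (v \<bullet> (X *v w))"
  using assms unfolding inner_conj_transpose skew_hermitian_def
  by (simp add: vector_matrix_mult_def matrix_vector_mult_def inner_vec_def sum_negf)

lemma matrix_vector_imult: "A *v (\<i> *s v) = \<i> *s (A *v v)" for A :: "complex ^ 'm ^ 'm"
  by (simp add: vector_scalar_commute)

text \<open>\<open>Q\<close> is the product of the two factors \<open>X - \<i> \<mu>1\<close> and
  \<open>X - \<i> \<mu>2\<close>, and \<open>S\<close> is its kernel. The self-adjoint map
  \<open>A = - \<i> X\<close> preserves the orthogonal complement \<open>W\<close> of
  \<open>S\<close>. If \<open>W\<close> were nonzero it would contain an eigenvector of
  \<open>A\<close>, whose eigenvalue can only be \<open>\<mu>1\<close> or \<open>\<mu>2\<close>, so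
  that it would lie in \<open>S\<close> too.\<close>

lemma skew_hermitian_two_eigenvalues:
  fixes X :: "complex ^ 'm ^ 'm" and \<mu>1 \<mu>2 :: real
  assumes skew: "skew_hermitian X"
    and ev: "eigenvalues X \<subseteq> {\<i> * complex_of_real \<mu>1, \<i> * complex_of_real \<mu>2}"
  shows "X *v (X *v v) = (\<mu>1 + \<mu>2) *\<^sub>R (\<i> *s (X *v v)) + (\<mu>1 * \<mu>2) *\<^sub>R v"
proof -
  interpret X: bounded_linear "(*v) X" by (rule bounded_linear_matrix_vector)
  interpret I: bounded_linear "\<lambda>v. \<i> *s v :: complex ^ 'm" by (rule bounded_linear_smult)
  define Q where "Q v = X *v (X *v v) - (\<mu>1 + \<mu>2) *\<^sub>R (\<i> *s (X *v v)) - (\<mu>1 * \<mu>2) *\<^sub>R v" for v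
  define S where "S = {v. Q v = 0}"
  define W where "W = {w. \<forall>v\<in>S. v \<bullet> w = 0}"
  define A where "A v = - (\<i> *s (X *v v))" for v
  note lin = X.add X.diff X.neg X.scaleR X.zero I.add I.diff I.neg I.scaleR I.zero matrix_vector_imult
  have Q_A: "Q (A v) = A (Q v)" for v by (simp add: Q_def A_def lin algebra_simps)
  have A_self: "A v \<bullet> w = v \<bullet> A w" for v w
    by (simp add: A_def inner_imult_left skew_hermitian_inner[OF skew] lin)
  have "linear A" by (rule linearI) (simp_all add: A_def lin)
  have "subspace S" by (auto simp: S_def Q_def subspace_def lin algebra_simps)
  have "subspace W" by (auto simp: W_def subspace_def inner_simps)
  have "A 0 = 0" by (simp add: A_def lin)
  have "A w \<in> W" if "w \<in> W" for w
    using that Q_A \<open>A 0 = 0\<close> unfolding W_def S_def by (auto simp: A_self[symmetric])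
  have "W = {0}"
  proof (rule ccontr)
    assume "W \<noteq> {0}"
    then obtain v m where v: "v \<in> W" "v \<noteq> 0" "A v = m *\<^sub>R v"
      using self_adjoint_eigenvector[OF \<open>linear A\<close> A_self \<open>subspace W\<close>] \<open>\<And>w. w \<in> W \<Longrightarrow> A w \<in> W\<close>
      by metis
    have "X *v v = \<i> *s A v" by (simp add: A_def lin)
    then have Xv: "X *v v = m *\<^sub>R (\<i> *s v)" by (simp add: v lin)
    then have "X *v v = (\<i> * complex_of_real m) *s v" by (simp add: scaleR_eq_smult mult.commute)
    then have "\<i> * complex_of_real m \<in> eigenvalues X" using v unfolding eigenvalues_def by blast
    then have "m = \<mu>1 \<or> m = \<mu>2" using ev by auto
    moreover have "Q v = (- (m - \<mu>1) * (m - \<mu>2)) *\<^sub>R v"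
      by (simp add: Q_def Xv lin scaleR_scaleR algebra_simps)
    ultimately have "Q v = 0" by auto
    then have "v \<bullet> v = 0" using v unfolding W_def S_def by blast
    then show False using v by simp
  qed
  have "v \<in> S"
  proof -
    obtain y z where yz: "y \<in> span S" "\<And>w. w \<in> span S \<Longrightarrow> orthogonal z w" "v = y + z"
      using orthogonal_subspace_decomp_exists by metis
    have "z \<in> W" using yz(2) span_base unfolding W_def orthogonal_def by (auto simp: inner_commute)
    then show ?thesis using \<open>W = {0}\<close> yz \<open>subspace S\<close>
      by (metis add.right_neutral span_eq_iff singletonD)
  qed
  then show ?thesis by (simp add: S_def Q_def algebra_simps)
qed

text \<open>The two conclusions are the real and the imaginary part of Hermitian orthogonality; they
  come from skewness applied to the pairs \<open>v\<close>, \<open>\<i> *s w\<close> and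
  \<open>v\<close>, \<open>w\<close>.\<close>

lemma eigenvectors_orthogonal:
  assumes "skew_hermitian X" "\<mu>1 \<noteq> \<mu>2" "X *v v = \<mu>1 *\<^sub>R (\<i> *s v)" "X *v w = \<mu>2 *\<^sub>R (\<i> *s w)"
  shows "v \<bullet> w = 0" "(\<i> *s v) \<bullet> w = 0"
proof -
  have "(\<mu>1 - \<mu>2) * (v \<bullet> w) = 0"
    using skew_hermitian_inner[OF assms(1), of v "\<i> *s w"] assms(3,4)
    by (simp add: matrix_vector_imult smult_scaleR algebra_simps)
  then show "v \<bullet> w = 0" using assms(2) by simp
  have "(\<mu>1 - \<mu>2) * ((\<i> *s v) \<bullet> w) = 0"
    using skew_hermitian_inner[OF assms(1), of v w] assms(3,4)
    using assms(2) by (auto simp add: inner_imult_left)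
  then show "(\<i> *s v) \<bullet> w = 0" using assms(2) by simp
qed

section \<open>The one-parameter group of \<open>X\<close> in closed form\<close>

locale skew_quadratic =
  fixes X :: "complex ^ 'm ^ 'm" and \<mu>1 \<mu>2 :: real
  assumes skew: "skew_hermitian X"
    and quadratic: "X *v (X *v v) = (\<mu>1 + \<mu>2) *\<^sub>R (\<i> *s (X *v v)) + (\<mu>1 * \<mu>2) *\<^sub>R v"
    and neq: "\<mu>1 \<noteq> \<mu>2"
begin

definition m where "m = (\<mu>1 + \<mu>2) / 2"
definition \<delta> where "\<delta> = (\<mu>1 - \<mu>2) / 2"
text \<open>A complex structure commuting with \<open>\<i>\<close>: it is \<open>\<i>\<close> on the
  eigenspace of \<open>\<mu>1\<close> and \<open>- \<i>\<close> on that of \<open>\<mu>2\<close>.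
  Thus \<open>X\<close> splits into the Hopf part \<open>m \<i>\<close> and the part
  \<open>\<delta> J\<close>, whose orbits are great circles.\<close>

definition J where "J v = (1 / \<delta>) *\<^sub>R (X *v v - m *\<^sub>R (\<i> *s v))"
text \<open>The exponentials of the commuting parts \<open>m \<i>\<close> and
  \<open>\<delta> J\<close>, multiplied; \<open>matrix_exp_flow\<close> identifies the product with
  the matrix exponential.\<close>

definition flow where "flow t v = cis (m * t) *s (cos (\<delta> * t) *\<^sub>R v + sin (\<delta> * t) *\<^sub>R J v)"

lemma \<delta>_nonzero: "\<delta> \<noteq> 0" using neq by (simp add: \<delta>_def)

sublocale X: bounded_linear "(*v) X" by (rule bounded_linear_matrix_vector)
sublocale I: bounded_linear "\<lambda>v. \<i> *s v :: complex ^ 'm" by (rule bounded_linear_smult)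

lemmas lin = X.add X.diff X.neg X.scaleR X.zero I.add I.diff I.neg I.scaleR I.zero matrix_vector_imult

lemma linear_J: "linear J"
  by (rule linearI) (simp_all add: J_def lin algebra_simps)

sublocale J: linear J by (rule linear_J)

lemma X_J: "X *v v = \<delta> *\<^sub>R J v + m *\<^sub>R (\<i> *s v)"
  using \<delta>_nonzero by (simp add: J_def)

text \<open>Completing the square in the quadratic relation gives
  \<open>(X - m \<i>)\<^sup>2 = - \<delta>\<^sup>2\<close>.\<close>

lemma J_J: "J (J v) = - v"
proof -
  have coeffs: "\<mu>1 + \<mu>2 = m + m" "\<mu>1 * \<mu>2 = m\<^sup>2 - \<delta>\<^sup>2"
    by (simp_all add: m_def \<delta>_def power2_eq_square field_simps)
  have "(\<delta>\<^sup>2) *\<^sub>R J (J v) = X *v (X *v v) - m *\<^sub>R (\<i> *s (X *v v)) - (m *\<^sub>R (\<i> *s (X *v v)) + m\<^sup>2 *\<^sub>R v)"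
  proof -
    have dJ: "\<delta> *\<^sub>R J w = X *v w - m *\<^sub>R (\<i> *s w)" for w
      using \<delta>_nonzero by (simp add: J_def)
    have "(\<delta>\<^sup>2) *\<^sub>R J (J v) = \<delta> *\<^sub>R (X *v J v - m *\<^sub>R (\<i> *s J v))"
      by (simp add: dJ[symmetric] power2_eq_square)
    also have "\<dots> = X *v (\<delta> *\<^sub>R J v) - m *\<^sub>R (\<i> *s (\<delta> *\<^sub>R J v))"
      by (simp add: X.scaleR I.scaleR scaleR_diff_right mult.commute)
    also have "\<dots> = X *v (X *v v) - m *\<^sub>R (\<i> *s (X *v v)) - (m *\<^sub>R (\<i> *s (X *v v)) + m\<^sup>2 *\<^sub>R v)"
      unfolding dJ by (simp only: lin scaleR_diff_right imult_imult scaleR_minus_right scaleR_scaleR power2_eq_square) simp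
    finally show ?thesis .
  qed
  also have "\<dots> = - (\<delta>\<^sup>2) *\<^sub>R v"
    unfolding quadratic coeffs scaleR_add_left scaleR_diff_left by simp
  finally have "(\<delta>\<^sup>2) *\<^sub>R (J (J v) + v) = 0" by (simp add: algebra_simps)
  then show ?thesis using \<delta>_nonzero by (simp add: add_eq_0_iff2)
qed

lemma J_skew: "J v \<bullet> w = - (v \<bullet> J w)"
  by (simp add: J_def inner_diff skew_hermitian_inner[OF skew] inner_imult_left algebra_simps)

lemma J_self [simp]: "J v \<bullet> v = 0" "v \<bullet> J v = 0"
  using J_skew[of v v] by (simp_all add: inner_commute)

lemma norm_J [simp]: "norm (J v) = norm v"
  by (simp add: norm_eq_sqrt_inner J_skew J_J)

lemma J_smult: "J (a *s v) = a *s J v"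
  by (simp add: J_def smult_scaleR vector_scalar_commute vec_eq_iff algebra_simps)

lemma norm_flow [simp]: "norm (flow t v) = norm v"
proof -
  have "J v \<bullet> J v = v \<bullet> v" by (simp add: J_skew J_J)
  then have "(norm (a *\<^sub>R v + b *\<^sub>R J v))\<^sup>2 = (a\<^sup>2 + b\<^sup>2) * (norm v)\<^sup>2" for a b
    unfolding power2_norm_eq_inner by (simp add: inner_add power2_eq_square algebra_simps)
  then have "(norm (cos (\<delta> * t) *\<^sub>R v + sin (\<delta> * t) *\<^sub>R J v))\<^sup>2 = (norm v)\<^sup>2"
    by simp
  then have "norm (cos (\<delta> * t) *\<^sub>R v + sin (\<delta> * t) *\<^sub>R J v) = norm v"
    by (rule power2_eq_imp_eq) simp_all
  then show ?thesis unfolding flow_def norm_smult by simp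
qed

lemma X_flow: "X *v flow t v = flow t (X *v v)"
proof -
  have "X *v J v = J (X *v v)" for v by (simp add: J_def lin)
  then show ?thesis by (simp add: flow_def vector_scalar_commute lin)
qed

lemma flow_0 [simp]: "flow 0 v = v"
  by (simp add: flow_def)

lemma flow_scaleR: "flow t (r *\<^sub>R v) = r *\<^sub>R flow t v"
  by (simp add: flow_def J.scaleR smult_scaleR[symmetric] scaleR_add_right algebra_simps)

lemma flow_has_vector_derivative:
  "((\<lambda>t. flow t v) has_vector_derivative X *v flow t v) (at t within T)"
proof -
  have "((\<lambda>t. cis (m * t)) has_vector_derivative m *\<^sub>R (\<i> * cis (m * t))) (at t within T)"
    unfolding has_vector_derivative_def by (auto intro!: derivative_eq_intros)
  moreover have "((\<lambda>t. cos (\<delta> * t) *\<^sub>R v + sin (\<delta> * t) *\<^sub>R J v) has_vector_derivative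
      (- \<delta> * sin (\<delta> * t)) *\<^sub>R v + (\<delta> * cos (\<delta> * t)) *\<^sub>R J v) (at t within T)"
    by (auto intro!: derivative_eq_intros simp: mult.commute)
  ultimately have "((\<lambda>t. flow t v) has_vector_derivative
      cis (m * t) *s ((- \<delta> * sin (\<delta> * t)) *\<^sub>R v + (\<delta> * cos (\<delta> * t)) *\<^sub>R J v)
      + (m *\<^sub>R (\<i> * cis (m * t))) *s (cos (\<delta> * t) *\<^sub>R v + sin (\<delta> * t) *\<^sub>R J v)) (at t within T)"
    unfolding flow_def by (rule bounded_bilinear.has_vector_derivative[OF bounded_bilinear_smult])
  moreover have "X *v flow t v = cis (m * t) *s ((- \<delta> * sin (\<delta> * t)) *\<^sub>R v + (\<delta> * cos (\<delta> * t)) *\<^sub>R J v)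
      + (m *\<^sub>R (\<i> * cis (m * t))) *s (cos (\<delta> * t) *\<^sub>R v + sin (\<delta> * t) *\<^sub>R J v)"
    unfolding X_J by (simp add: flow_def J_smult J.add J.scaleR J_J vec_eq_iff algebra_simps)
  ultimately show ?thesis by simp
qed

text \<open>Lagrange interpolation at the eigenvalues \<open>l1\<close>, \<open>l2\<close>:
  \<open>M1 x\<close> is \<open>x\<close> times \<open>(X - l2) / D\<close> and \<open>M2 x\<close>
  is \<open>x\<close> times \<open>(l1 - X) / D\<close>, the spectral projections. Every power of
  \<open>t X\<close> is then a sum of scalar powers pushed through the linear maps \<open>M1\<close>
  and \<open>M2\<close>, so convergence and value of the matrix series follow from two scalar
  exponential series.\<close>

lemma matrix_exp_flow: "matrix_exp (t *\<^sub>R X) *v v = flow t v"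
proof -
  define l1 l2 where "l1 = \<i> * complex_of_real \<mu>1" and "l2 = \<i> * complex_of_real \<mu>2"
  define D where "D = l1 - l2"
  have D: "D \<noteq> 0" using neq by (simp add: D_def l1_def l2_def)
  define M1 where "M1 x = mat (x * - (l2 / D)) + mat (x * (1 / D)) ** X" for x
  define M2 where "M2 x = mat (x * (l1 / D)) + mat (x * - (1 / D)) ** X" for x
  have mat_vec: "mat c *v w = c *s w" for c and w :: "complex ^ 'm"
    by (simp add: vec_eq_iff matrix_vector_mult_def mat_def if_distrib if_distribR cong: if_cong)
  have mat_add: "mat (c + d) = mat c + (mat d :: complex ^ 'm ^ 'm)" for c d
    by (simp add: vec_eq_iff mat_def)
  have mat_scaleR: "mat (r *\<^sub>R c) = r *\<^sub>R (mat c :: complex ^ 'm ^ 'm)" for r c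
    by (simp add: vec_eq_iff mat_def)
  have scaleR_mult: "(r *\<^sub>R A) ** B = r *\<^sub>R (A ** B)" for r and A B :: "complex ^ 'm ^ 'm"
    by (simp add: vec_eq_iff matrix_matrix_mult_def scaleR_sum_right)
  have mult_add: "(A + B) ** C = A ** C + B ** C" for A B C :: "complex ^ 'm ^ 'm"
    by (simp add: vec_eq_iff matrix_matrix_mult_def sum.distrib distrib_right)
  have scaleR_vec: "(r *\<^sub>R A) *v w = r *\<^sub>R (A *v w)" for r and A :: "complex ^ 'm ^ 'm" and w
    by (simp add: vec_eq_iff matrix_vector_mult_def scaleR_sum_right)
  have M_vec: "(M1 x + M2 y) *v w = ((y * l1 - x * l2) / D) *s w + ((x - y) / D) *s (X *v w)" for x y w
    by (simp add: M1_def M2_def matrix_vector_mult_add_rdistrib mat_vec matrix_vector_mul_assoc[symmetric]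
        vec_eq_iff diff_divide_distrib algebra_simps)
  have XX: "X *v (X *v w) = (l1 + l2) *s (X *v w) - (l1 * l2) *s w" for w
    unfolding quadratic
    by (simp add: vec_eq_iff l1_def l2_def) (simp add: scaleR_conv_of_real algebra_simps)
  have pow: "((**) (t *\<^sub>R X) ^^ k) (mat 1) = M1 ((t * l1) ^ k) + M2 ((t * l2) ^ k)" for k
    unfolding matrix_eq
  proof (rule allI, induction k)
    case 0
    show ?case using D by (simp add: M_vec D_def[symmetric])
  next
    case (Suc k)
    define x y where "x = (t * l1) ^ k" and "y = (t * l2) ^ k"
    fix w :: "complex ^ 'm"
    have "((**) (t *\<^sub>R X) ^^ Suc k) (mat 1) *v w
        = t *\<^sub>R (X *v (((y * l1 - x * l2) / D) *s w + ((x - y) / D) *s (X *v w)))"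
      using Suc by (simp add: matrix_vector_mul_assoc[symmetric] scaleR_vec M_vec x_def y_def)
    also have "\<dots> = ((t * l2 * y * l1 - t * l1 * x * l2) / D) *s w + ((t * l1 * x - t * l2 * y) / D) *s (X *v w)"
      by (simp add: matrix_vector_right_distrib vector_scalar_commute XX vec_eq_iff)
        (simp add: scaleR_conv_of_real add_divide_distrib diff_divide_distrib algebra_simps)
    finally show "((**) (t *\<^sub>R X) ^^ Suc k) (mat 1) *v w = (M1 ((t * l1) ^ Suc k) + M2 ((t * l2) ^ Suc k)) *v w"
      by (simp add: M_vec x_def y_def)
  qed
  have lin1: "linear M1"
    by (intro linearI; simp only: M1_def distrib_right mat_add mult_add mult_scaleR_left mat_scaleR
        scaleR_mult scaleR_add_right ac_simps)
  have lin2: "linear M2"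
    by (intro linearI; simp only: M2_def distrib_right mat_add mult_add mult_scaleR_left mat_scaleR
        scaleR_mult scaleR_add_right ac_simps)
  have "(\<lambda>k. M1 ((t * l1) ^ k /\<^sub>R fact k) + M2 ((t * l2) ^ k /\<^sub>R fact k)) sums (M1 (exp (t * l1)) + M2 (exp (t * l2)))"
    by (rule sums_add; rule bounded_linear.sums[OF _ exp_converges])
      (rule linear_conv_bounded_linear[THEN iffD1], rule lin1 lin2)+
  then have "(\<lambda>k. (1 / fact k) *\<^sub>R (((**) (t *\<^sub>R X) ^^ k) (mat 1))) sums (M1 (exp (t * l1)) + M2 (exp (t * l2)))"
    by (simp add: pow linear_cmul[OF lin1] linear_cmul[OF lin2] scaleR_add_right inverse_eq_divide)
  then have "matrix_exp (t *\<^sub>R X) = M1 (exp (t * l1)) + M2 (exp (t * l2))"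
    unfolding matrix_exp_def by (simp add: sums_iff)
  then have *: "matrix_exp (t *\<^sub>R X) *v v = ((exp (t * l2) * l1 - exp (t * l1) * l2) / D) *s v
      + ((exp (t * l1) - exp (t * l2)) / D) *s (X *v v)"
    by (simp add: M_vec)
  define e where "e = cis (m * t)"
  define C S where "C = complex_of_real (cos (\<delta> * t))" and "S = complex_of_real (sin (\<delta> * t))"
  have D': "D = 2 * \<i> * \<delta>" by (simp add: D_def l1_def l2_def \<delta>_def algebra_simps)
  have "exp (t * l1) = e * cis (\<delta> * t)" "exp (t * l2) = e * cis (- (\<delta> * t))"
    unfolding e_def cis_mult by (simp_all add: l1_def l2_def cis_conv_exp m_def \<delta>_def field_simps)
  moreover have "cis (\<delta> * t) = C + \<i> * S" "cis (- (\<delta> * t)) = C - \<i> * S"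
    by (simp_all add: C_def S_def complex_eq_iff)
  ultimately have ex: "exp (t * l1) = e * (C + \<i> * S)" "exp (t * l2) = e * (C - \<i> * S)" by simp_all
  have l: "l1 = \<i> * (m + \<delta>)" "l2 = \<i> * (m - \<delta>)"
    by (simp_all add: l1_def l2_def m_def \<delta>_def field_simps)
  have d0: "complex_of_real \<delta> \<noteq> 0" using \<delta>_nonzero by simp
  have b: "(exp (t * l1) - exp (t * l2)) / D = e * S / \<delta>"
    unfolding ex D' using d0 by (simp add: field_simps)
  have a: "(exp (t * l2) * l1 - exp (t * l1) * l2) / D = e * C - \<i> * m * (e * S / \<delta>)"
    unfolding ex D' unfolding l using d0 by (simp add: field_simps)
  have "matrix_exp (t *\<^sub>R X) *v v = (e * C - \<i> * m * (e * S / \<delta>)) *s v + (e * S / \<delta>) *s (\<delta> *\<^sub>R J v + m *\<^sub>R (\<i> *s v))"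
    unfolding * a b X_J[of v] ..
  also have "\<dots> = flow t v"
    unfolding flow_def scaleR_eq_smult e_def[symmetric] C_def[symmetric] S_def[symmetric]
    using d0 by (simp add: vec_eq_iff field_simps)
  finally show ?thesis .
qed

end

section \<open>Zermelo navigation\<close>

text \<open>Defined for all pairs, not only for tangent vectors, and hence continuous on the whole
  space, as the integrability of lengths requires.\<close>

definition randers_fun :: "real \<Rightarrow> real \<Rightarrow> real \<Rightarrow> complex ^ 'm \<Rightarrow> complex ^ 'm \<Rightarrow> real" where
  "randers_fun a b c x v = sqrt (a * (v \<bullet> v) + b * ((\<i> *s x) \<bullet> v)\<^sup>2) + c * ((\<i> *s x) \<bullet> v)"

lemma continuous_randers_fun: "continuous_on UNIV (\<lambda>(x, v). randers_fun a b c x v)"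
  unfolding randers_fun_def case_prod_unfold
  by (intro continuous_intros bounded_linear.continuous_on[OF bounded_linear_smult])

lemma unitary_randers_fun:
  assumes "unitary U" shows "randers_fun a b c (U *v x) (U *v v) = randers_fun a b c x v"
  by (simp add: randers_fun_def unitary_inner[OF assms] matrix_vector_imult[symmetric])

lemma inner_imult_bound:
  assumes "norm x = 1" shows "((\<i> *s x) \<bullet> v)\<^sup>2 \<le> v \<bullet> v"
  using Cauchy_Schwarz_ineq[of "\<i> *s x" v] assms by (simp add: norm_eq_1)

text \<open>A metric is specified on tangent vectors only, and velocities are tangent except
  possibly at break points and end points; these are finitely many and negligible.\<close>

lemma finsler_length_cong:
  assumes "piecewise_smooth_curve \<gamma>" "\<gamma> ` {0..1} \<subseteq> usphere"
    and "\<And>x v. x \<in> usphere \<Longrightarrow> v \<in> tsp x \<Longrightarrow> F x v = G x v"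
  shows "finsler_length F \<gamma> = finsler_length G \<gamma>"
proof -
  from assms(1) obtain K where K: "finite K"
    "\<And>t. t \<in> {0<..<1} - K \<Longrightarrow> (\<gamma> has_vector_derivative vector_derivative \<gamma> (at t)) (at t)"
    by (rule piecewise_smooth_curveE) blast
  show ?thesis unfolding finsler_length_def
  proof (rule integral_spike[of "K \<union> {0, 1}"])
    show "negligible (K \<union> {0, 1})" using K(1) by (intro negligible_finite) simp
    fix t :: real assume "t \<in> {0..1} - (K \<union> {0, 1})"
    then have t: "t \<in> {0<..<1} - K" by auto
    then have "\<gamma> t \<in> usphere" using assms(2) by (auto simp: image_subset_iff)
    moreover have "vector_derivative \<gamma> (at t) \<in> tsp (\<gamma> t)"
      using tangent_curve[OF assms(2)] K(2)[OF t] t by blast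
    ultimately show "G (\<gamma> t) (vector_derivative \<gamma> (at t)) = F (\<gamma> t) (vector_derivative \<gamma> (at t))"
      using assms(3) by simp
  qed
qed

lemma finsler_dist_cong:
  assumes "\<And>x v. x \<in> usphere \<Longrightarrow> v \<in> tsp x \<Longrightarrow> F x v = G x v"
  shows "finsler_dist F x y = finsler_dist G x y"
  unfolding finsler_dist_def
  by (intro arg_cong[where f = Inf] image_cong refl finsler_length_cong[OF _ _ assms]) auto

text \<open>The metric \<open>randers_fun 1 c\<^sup>2 c\<close> solves Zermelo's navigation problem on a round sphere with a
  multiple of the Hopf field as wind: rotating each point of a curve by \<open>cis (c \<tau>)\<close>, where \<open>\<tau>\<close> is the
  \<open>F\<close>-length up to that point, gives a curve of \<open>sqrt (1 + c\<^sup>2)\<close> times that length in the round metric.\<close>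

lemma zermelo_norm:
  assumes "norm x = 1" "x \<bullet> v = 0" and f: "f = randers_fun 1 (c\<^sup>2) c x v"
  shows "norm (v + (c * f) *\<^sub>R (\<i> *s x)) = sqrt (1 + c\<^sup>2) * f"
proof -
  define s where "s = (\<i> *s x) \<bullet> v"
  have xx: "x \<bullet> x = 1" using assms(1) by (simp add: norm_eq_1)
  have vs: "v \<bullet> (\<i> *s x) = s" "(\<i> *s x) \<bullet> v = s" by (simp_all add: s_def inner_commute)
  have f': "f - c * s = sqrt (v \<bullet> v + c\<^sup>2 * s\<^sup>2)" by (simp add: f randers_fun_def s_def)
  \<comment> \<open>With \<open>b = c\<^sup>2\<close> the terms \<open>c\<^sup>2 * s\<^sup>2\<close>
    on both sides cancel, which leaves \<open>v \<bullet> v\<close> as an expression linear in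
    \<open>s\<close>.\<close>
  then have "(f - c * s)\<^sup>2 = v \<bullet> v + c\<^sup>2 * s\<^sup>2" by simp
  then have vv: "v \<bullet> v = f\<^sup>2 - 2 * c * s * f" by (simp only: power2_eq_square) argo
  have "\<bar>c * s\<bar> \<le> sqrt (v \<bullet> v + c\<^sup>2 * s\<^sup>2)"
    by (rule real_le_rsqrt) (simp add: power_mult_distrib)
  then have f0: "0 \<le> f" using f' by linarith
  have "(norm (v + (c * f) *\<^sub>R (\<i> *s x)))\<^sup>2 = v \<bullet> v + 2 * c * f * s + (c * f)\<^sup>2"
    unfolding power2_norm_eq_inner using vs by (simp add: inner_add xx power2_eq_square algebra_simps)
  also have "\<dots> = (sqrt (1 + c\<^sup>2) * f)\<^sup>2"
  proof -
    have "(sqrt (1 + c\<^sup>2) * f)\<^sup>2 = (1 + c\<^sup>2) * f\<^sup>2"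
      unfolding power_mult_distrib by (subst real_sqrt_pow2) simp_all
    then show ?thesis unfolding vv by (simp add: power_mult_distrib algebra_simps)
  qed
  finally show ?thesis
    by (rule power2_eq_imp_eq) (use f0 in simp_all)
qed

lemma randers_fun_nonneg: "0 \<le> randers_fun 1 (c\<^sup>2) c x v"
proof -
  have "\<bar>c * ((\<i> *s x) \<bullet> v)\<bar> \<le> sqrt (v \<bullet> v + c\<^sup>2 * ((\<i> *s x) \<bullet> v)\<^sup>2)"
    by (rule real_le_rsqrt) (simp add: power_mult_distrib)
  then show ?thesis by (simp add: randers_fun_def)
qed

text \<open>Only the part of \<open>x\<close> orthogonal to \<open>y\<close> contributes, and its
  length is the sine of the angle between them. Hence the angle from \<open>x\<close> grows along a
  curve on the sphere no faster than arc length.\<close>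

lemma inner_sphere_derivative_bound:
  fixes x :: "'a::real_inner"
  assumes "norm x = 1" "norm y = 1" "y \<bullet> w = 0"
  shows "\<bar>x \<bullet> w\<bar> \<le> sqrt (1 - (x \<bullet> y)\<^sup>2) * norm w"
proof -
  have "x \<bullet> w = (x - (x \<bullet> y) *\<^sub>R y) \<bullet> w" using assms by (simp add: inner_diff)
  then have "\<bar>x \<bullet> w\<bar> \<le> norm (x - (x \<bullet> y) *\<^sub>R y) * norm w"
    using Cauchy_Schwarz_ineq2 by metis
  moreover have "(norm (x - (x \<bullet> y) *\<^sub>R y))\<^sup>2 = 1 - (x \<bullet> y)\<^sup>2"
    using assms unfolding power2_norm_eq_inner norm_eq_1
    by (simp add: inner_diff inner_commute power2_eq_square algebra_simps)
  then have "norm (x - (x \<bullet> y) *\<^sub>R y) = sqrt (1 - (x \<bullet> y)\<^sup>2)" 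
    by (metis norm_ge_zero real_sqrt_unique)
  ultimately show ?thesis by simp
qed

text \<open>The rotated curve \<open>\<eta>\<close> has round speed \<open>R * f\<close>, so its end
  is at angle at most \<open>R * L\<close> from its start. The bound by \<open>pi\<close> allows
  passing from angles to cosines.\<close>

lemma zermelo_lower_bound:
  fixes \<gamma> :: "real \<Rightarrow> complex ^ 'm"
  assumes "piecewise_smooth_curve \<gamma>" "\<gamma> ` {0..1} \<subseteq> usphere"
    and L: "L = finsler_length (randers_fun 1 (c\<^sup>2) c) \<gamma>"
    and "sqrt (1 + c\<^sup>2) * L \<le> pi"
  shows "0 \<le> L" "cos (sqrt (1 + c\<^sup>2) * L) \<le> \<gamma> 0 \<bullet> (cis (c * L) *s \<gamma> 1)"
proof -
  define x where "x = \<gamma> 0"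
  define R where "R = sqrt (1 + c\<^sup>2)"
  define \<gamma>' where "\<gamma>' t = vector_derivative \<gamma> (at t)" for t
  define f where "f t = randers_fun 1 (c\<^sup>2) c (\<gamma> t) (\<gamma>' t)" for t
  from assms(1) obtain K where K: "finite K" and cont: "continuous_on {0..1} \<gamma>"
    and der: "\<And>t. t \<in> {0<..<1} - K \<Longrightarrow> (\<gamma> has_vector_derivative \<gamma>' t) (at t)"
    and isc: "\<And>t. t \<in> {0<..<1} - K \<Longrightarrow> isCont \<gamma>' t"
    and int: "\<And>\<Phi>. continuous_on UNIV (\<lambda>(x, v). \<Phi> x v) \<Longrightarrow> (\<lambda>t. \<Phi> (\<gamma> t) (\<gamma>' t) :: real) integrable_on {0..1}"
    unfolding \<gamma>'_def by (rule piecewise_smooth_curveE) blast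
  have norm_\<gamma>: "norm (\<gamma> t) = 1" if "t \<in> {0..1}" for t
    using that assms(2) by force
  have f_int: "f integrable_on {0..1}"
    unfolding f_def by (rule int[OF continuous_randers_fun])
  have f0: "0 \<le> f t" for t by (simp add: f_def randers_fun_nonneg)
  define T where "T t = integral {0..t} f" for t
  have T1: "T 1 = L" by (simp add: T_def L finsler_length_def f_def[abs_def] \<gamma>'_def)
  show L0: "0 \<le> L" unfolding T1[symmetric] T_def by (rule integral_nonneg[OF f_int f0])
  have T_cont: "continuous_on {0..1} T"
    unfolding T_def by (rule indefinite_integral_continuous_1[OF f_int])
  have T_der: "(T has_vector_derivative f t) (at t)" if t: "t \<in> {0<..<1} - K" for t
  proof -
    have "isCont \<gamma> t" using der[OF t] has_vector_derivative_continuous by blast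
    then have "isCont (\<lambda>t. (\<gamma> t, \<gamma>' t)) t" using isc[OF t] by (intro continuous_intros)
    moreover have "isCont (\<lambda>(x, v). randers_fun 1 (c\<^sup>2) c x v) (\<gamma> t, \<gamma>' t)"
      using continuous_randers_fun[THEN continuous_on_eq_continuous_at[OF open_UNIV, THEN iffD1]] by blast
    ultimately have "isCont ((\<lambda>(x, v). randers_fun 1 (c\<^sup>2) c x v) \<circ> (\<lambda>t. (\<gamma> t, \<gamma>' t))) t"
      by (rule continuous_at_compose)
    then have "isCont f t" by (simp add: o_def f_def[abs_def])
    then have "(T has_vector_derivative f t) (at t within {0..1})"
      using integral_has_vector_derivative_continuous_at[OF f_int, of t "{}"] t
      by (auto simp: T_def[abs_def] continuous_at_imp_continuous_within)
    then show ?thesis using t by (simp add: at_within_Icc_at)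
  qed
  define \<eta> where "\<eta> t = cis (c * T t) *s \<gamma> t" for t
  define \<eta>' where "\<eta>' t = cis (c * T t) *s (\<gamma>' t + (c * f t) *\<^sub>R (\<i> *s \<gamma> t))" for t
  have norm_\<eta>: "norm (\<eta> t) = 1" if "t \<in> {0..1}" for t
    using norm_\<gamma>[OF that] by (simp add: \<eta>_def norm_smult)
  have \<eta>_cont: "continuous_on {0..1} \<eta>"
    unfolding \<eta>_def
    by (intro bounded_bilinear.continuous_on[OF bounded_bilinear_smult] cont continuous_intros T_cont)
  have \<eta>_der: "(\<eta> has_vector_derivative \<eta>' t) (at t)" if t: "t \<in> {0<..<1} - K" for t
  proof -
    have "((\<lambda>t. cis (c * T t)) has_vector_derivative (c * f t) *\<^sub>R (\<i> * cis (c * T t))) (at t)"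
      using T_der[OF t] unfolding has_vector_derivative_def
      by (auto intro!: derivative_eq_intros simp: fun_eq_iff scaleR_scaleR algebra_simps)
    from bounded_bilinear.has_vector_derivative[OF bounded_bilinear_smult this der[OF t]]
    have "(\<eta> has_vector_derivative cis (c * T t) *s \<gamma>' t + ((c * f t) *\<^sub>R (\<i> * cis (c * T t))) *s \<gamma> t) (at t)"
      unfolding \<eta>_def .
    moreover have "cis (c * T t) *s \<gamma>' t + ((c * f t) *\<^sub>R (\<i> * cis (c * T t))) *s \<gamma> t = \<eta>' t"
      by (simp add: \<eta>'_def vec_eq_iff algebra_simps)
    ultimately show ?thesis by simp
  qed
  have norm_\<eta>': "norm (\<eta>' t) = R * f t" if t: "t \<in> {0<..<1} - K" for t
  proof -
    have "\<gamma>' t \<in> tsp (\<gamma> t)" using tangent_curve[OF assms(2)] der[OF t] t by blast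
    then show ?thesis
      using zermelo_norm[of "\<gamma> t" "\<gamma>' t" "f t" c] norm_\<gamma>[of t] t
      unfolding \<eta>'_def norm_smult by (simp add: R_def f_def tsp_def)
  qed
  have \<eta>_tan: "\<eta> t \<bullet> \<eta>' t = 0" if t: "t \<in> {0<..<1} - K" for t
  proof -
    have "\<eta> ` {0..1} \<subseteq> usphere" using norm_\<eta> by auto
    from tangent_curve[OF this _ \<eta>_der[OF t]] t show ?thesis by (simp add: tsp_def)
  qed
  \<comment> \<open>\<open>arccos\<close> is not differentiable at \<open>1\<close>, where the curve starts; hence the factor \<open>r < 1\<close>.\<close>
  have dist_bound: "arccos (r * (x \<bullet> \<eta> 1)) \<le> arccos r + R * L" if r: "0 < r" "r < 1" for r
  proof -
    define h where "h t = r * (x \<bullet> \<eta> t)" for t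
    have h1: "\<bar>h t\<bar> \<le> r" if "t \<in> {0..1}" for t
      using Cauchy_Schwarz_ineq2[of x "\<eta> t"] norm_\<eta>[OF that] norm_\<gamma>[of 0] r
      by (simp add: h_def x_def abs_mult mult_left_le)
    \<comment> \<open>The value 0 at exceptional parameters makes the comparison
      \<open>g t \<le> R * f t\<close> hold everywhere.\<close>
    define g where "g t = (if t \<in> {0<..<1} - K then - (r * (x \<bullet> \<eta>' t)) / sqrt (1 - (h t)\<^sup>2) else 0)" for t
    have "((\<lambda>t. arccos (h t)) has_vector_derivative g t) (at t)" if t: "t \<in> {0<..<1} - K" for t
    proof -
      have "(h has_vector_derivative r * (x \<bullet> \<eta>' t)) (at t)"
        unfolding h_def
        by (intro bounded_linear.has_vector_derivative[OF _ \<eta>_der[OF t]] bounded_linear_const_mult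
            bounded_linear_inner_right)
      then have "(h has_real_derivative r * (x \<bullet> \<eta>' t)) (at t)"
        by (simp add: has_real_derivative_iff_has_vector_derivative)
      moreover have "-1 < h t" "h t < 1" using h1[of t] t r by auto
      ultimately have "((\<lambda>t. arccos (h t)) has_real_derivative inverse (- sqrt (1 - (h t)\<^sup>2)) * (r * (x \<bullet> \<eta>' t))) (at t)"
        by (intro DERIV_chain2[OF DERIV_arccos])
      then show ?thesis using t by (simp add: g_def has_real_derivative_iff_has_vector_derivative divide_inverse mult.commute)
    qed
    moreover have "continuous_on {0..1} (\<lambda>t. arccos (h t))"
    proof (rule continuous_on_arccos)
      show "continuous_on {0..1} h" unfolding h_def by (intro continuous_intros \<eta>_cont)
      show "\<forall>t\<in>{0..1}. -1 \<le> h t \<and> h t \<le> 1" using h1 r by fastforce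
    qed
    ultimately have "(g has_integral (arccos (h 1) - arccos (h 0))) {0..1}"
      by (intro fundamental_theorem_of_calculus_interior_strong[OF K]) auto
    moreover have "((\<lambda>t. R * f t) has_integral R * L) {0..1}"
      using f_int has_integral_mult_right[OF integrable_integral] T1 unfolding T_def by metis
    moreover have "g t \<le> R * f t" for t
    proof (cases "t \<in> {0<..<1} - K")
      case True
      have "\<bar>x \<bullet> \<eta>' t\<bar> \<le> sqrt (1 - (x \<bullet> \<eta> t)\<^sup>2) * (R * f t)"
        using inner_sphere_derivative_bound[OF _ norm_\<eta>[of t] \<eta>_tan[OF True], of x] True norm_\<gamma>[of 0]
        by (simp add: norm_\<eta>'[OF True] x_def)
      then have "r * \<bar>x \<bullet> \<eta>' t\<bar> \<le> (r * sqrt (1 - (x \<bullet> \<eta> t)\<^sup>2)) * (R * f t)"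
        using r by (simp add: mult.assoc)
      also have "r * sqrt (1 - (x \<bullet> \<eta> t)\<^sup>2) = sqrt (r\<^sup>2 - (h t)\<^sup>2)"
      proof -
        have "sqrt (r\<^sup>2 - (h t)\<^sup>2) = sqrt (r\<^sup>2 * (1 - (x \<bullet> \<eta> t)\<^sup>2))"
          by (simp add: h_def power_mult_distrib algebra_simps)
        then show ?thesis using r by (simp add: real_sqrt_mult)
      qed
      also have "\<dots> * (R * f t) \<le> sqrt (1 - (h t)\<^sup>2) * (R * f t)"
        using r f0[of t] by (intro mult_right_mono) (auto simp: R_def power_le_one)
      finally have "r * \<bar>x \<bullet> \<eta>' t\<bar> \<le> sqrt (1 - (h t)\<^sup>2) * (R * f t)" .
      moreover have "(h t)\<^sup>2 < 1" using h1[of t] True r by (simp add: abs_square_less_1)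
      ultimately have "r * \<bar>x \<bullet> \<eta>' t\<bar> / sqrt (1 - (h t)\<^sup>2) \<le> R * f t" by (simp add: field_simps)
      moreover have "g t \<le> r * \<bar>x \<bullet> \<eta>' t\<bar> / sqrt (1 - (h t)\<^sup>2)"
      proof -
        have "- (r * (x \<bullet> \<eta>' t)) \<le> r * \<bar>x \<bullet> \<eta>' t\<bar>"
          using mult_left_mono[of "- (x \<bullet> \<eta>' t)" "\<bar>x \<bullet> \<eta>' t\<bar>" r] r by simp
        then show ?thesis
          unfolding g_def if_P[OF True] using \<open>(h t)\<^sup>2 < 1\<close> by (intro divide_right_mono) simp_all
      qed
      ultimately show ?thesis by simp
    qed (use f0[of t] in \<open>auto simp: g_def R_def\<close>)
    ultimately have "arccos (h 1) - arccos (h 0) \<le> R * L"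
      by (rule has_integral_le)
    moreover have "h 0 = r"
      using norm_\<gamma>[of 0] by (simp add: h_def \<eta>_def T_def x_def norm_eq_1)
    ultimately show ?thesis by (simp add: h_def[of 1])
  qed
  define p where "p = x \<bullet> \<eta> 1"
  have p: "\<bar>p\<bar> \<le> 1"
    using Cauchy_Schwarz_ineq2[of x "\<eta> 1"] norm_\<eta>[of 1] norm_\<gamma>[of 0] by (simp add: p_def x_def)
  have lim: "((\<lambda>r. arccos (r * q)) \<longlongrightarrow> arccos q) (at_left 1)" if q: "\<bar>q\<bar> \<le> 1" for q :: real
  proof -
    have "continuous_on {0..1} (\<lambda>r. arccos (r * q))"
    proof (rule continuous_on_arccos)
      show "\<forall>r\<in>{0..1}. - 1 \<le> r * q \<and> r * q \<le> 1"
      proof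
        fix r :: real assume "r \<in> {0..1}"
        then have "\<bar>r * q\<bar> \<le> 1" using q by (simp add: abs_mult mult_le_one)
        then show "- 1 \<le> r * q \<and> r * q \<le> 1" by linarith
      qed
    qed (intro continuous_intros)
    then show ?thesis
      using continuous_on_Icc_at_leftD[of 0 1 "\<lambda>r. arccos (r * q)"] by simp
  qed
  \<comment> \<open>Let \<open>r\<close> tend to 1: \<open>arccos\<close> is still continuous there,
    so the auxiliary factor disappears.\<close>
  have "arccos p \<le> 0 + R * L"
  proof (rule tendsto_le[OF _ _ lim[OF p]])
    show "((\<lambda>r. arccos r + R * L) \<longlongrightarrow> 0 + R * L) (at_left 1)"
      using lim[of 1] by (intro tendsto_intros) simp
    show "\<forall>\<^sub>F r in at_left 1. arccos (r * p) \<le> arccos r + R * L"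
      using dist_bound unfolding p_def eventually_at_left_field by (intro exI[of _ 0]) auto
  qed simp
  then have "cos (R * L) \<le> cos (arccos p)"
    using assms(4) arccos_bounded[of p] p by (intro cos_monotone_0_pi_le) (auto simp: R_def)
  then show "cos (sqrt (1 + c\<^sup>2) * L) \<le> \<gamma> 0 \<bullet> (cis (c * L) *s \<gamma> 1)"
    using p by (simp add: R_def p_def \<eta>_def T1 x_def)
qed

section \<open>Existence\<close>

lemma randers_fun_scaleR:
  assumes "0 \<le> t" shows "randers_fun a b c x (t *\<^sub>R v) = t * randers_fun a b c x v"
proof -
  have "a * (t *\<^sub>R v \<bullet> t *\<^sub>R v) + b * ((\<i> *s x) \<bullet> t *\<^sub>R v)\<^sup>2
      = t\<^sup>2 * (a * (v \<bullet> v) + b * ((\<i> *s x) \<bullet> v)\<^sup>2)"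
    by (simp add: algebra_simps power_mult_distrib) (simp add: power2_eq_square)
  then have "sqrt (a * (t *\<^sub>R v \<bullet> t *\<^sub>R v) + b * ((\<i> *s x) \<bullet> t *\<^sub>R v)\<^sup>2)
      = t * sqrt (a * (v \<bullet> v) + b * ((\<i> *s x) \<bullet> v)\<^sup>2)"
    using assms by (simp only: real_sqrt_mult real_sqrt_abs abs_of_nonneg)
  then show ?thesis
    unfolding randers_fun_def by (simp only: distrib_left inner_scaleR_right mult.left_commute)
qed

lemma finsler_isometry_unitary:
  fixes U :: "complex ^ 'm ^ 'm"
  assumes U: "unitary U" and F: "unitary_invariant F"
  shows "finsler_isometry F ((*v) U)"
proof -
  have U': "unitary (conj_transpose U)"
    using U unfolding unitary_def conj_transpose_def
    by (simp add: transpose_def map_matrix_def vec_eq_iff)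
  have inv1: "conj_transpose U *v (U *v x) = x" and inv2: "U *v (conj_transpose U *v x) = x" for x
    using U by (simp_all add: unitary_def matrix_vector_mul_assoc)
  have bij: "bij_betw ((*v) U) usphere usphere"
    by (rule bij_betw_byWitness[where f' = "(*v) (conj_transpose U)"])
      (auto simp: inv1 inv2 unitary_norm[OF U] unitary_norm[OF U'])
  have "inv_into usphere ((*v) U) y = conj_transpose U *v y" if "y \<in> usphere" for y
    using that bij inv2 unitary_norm[OF U']
    by (intro inv_into_f_eq) (auto simp: bij_betw_def)
  then have "smooth_on usphere (inv_into usphere ((*v) U))"
    using smooth_on_cong[of usphere "inv_into usphere ((*v) U)" "(*v) (conj_transpose U)"]
      smooth_on_bounded_linear[OF bounded_linear_matrix_vector] by blast
  moreover have "((*v) U has_derivative (*v) U) (at x within usphere)" for x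
    by (rule bounded_linear_imp_has_derivative[OF bounded_linear_matrix_vector])
  ultimately show ?thesis
    using bij F U smooth_on_bounded_linear[OF bounded_linear_matrix_vector]
    unfolding finsler_isometry_def unitary_invariant_def by blast
qed

section \<open>Orbits of the flow as curves on the sphere\<close>

context skew_quadratic begin

lemma unitary_matrix_exp: "unitary (matrix_exp (t *\<^sub>R X))"
  by (rule unitaryI) (simp add: matrix_exp_flow)

lemma flow_has_vector_derivative_scaled:
  "((\<lambda>\<tau>. flow (\<tau> * t) v) has_vector_derivative t *\<^sub>R (X *v flow (\<tau> * t) v)) (at \<tau>)"
proof -
  have "((\<lambda>\<tau>. \<tau> * t) has_vector_derivative t) (at \<tau>)"
    by (auto intro!: derivative_eq_intros)
  from vector_diff_chain_at[OF this flow_has_vector_derivative] show ?thesis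
    by (simp add: o_def)
qed

text \<open>The derivative of an orbit is again an orbit, through a multiple of
  \<open>X *v v\<close>; the induction over all starting vectors therefore closes.\<close>

lemma piecewise_smooth_flow: "piecewise_smooth_curve (\<lambda>\<tau>. flow (\<tau> * t) v)"
proof -
  have "Ck_on k UNIV (\<lambda>\<tau>. flow (\<tau> * t) v)" for k
  proof (induction k arbitrary: v)
    case 0
    show ?case
      using flow_has_vector_derivative_scaled has_vector_derivative_continuous
      by (fastforce simp: continuous_on_eq_continuous_at)
  next
    case (Suc k)
    have "((\<lambda>\<tau>. flow (\<tau> * t) v) has_derivative (\<lambda>h. flow (\<tau> * t) ((h * t) *\<^sub>R (X *v v)))) (at \<tau>)" for \<tau>
      using flow_has_vector_derivative_scaled[of t v \<tau>]
      by (simp add: has_vector_derivative_def flow_scaleR X_flow)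
    then show ?case by (rule Ck_on_SucI[OF open_UNIV]) (rule Suc.IH)
  qed
  then have "smooth_on A (\<lambda>\<tau>. flow (\<tau> * t) v)" for A
    unfolding smooth_on_def by (metis UNIV_I open_UNIV)
  then show ?thesis
    unfolding piecewise_smooth_curve_def by (intro exI[of _ 1] exI[of _ real]) simp
qed

text \<open>The velocity is the image of \<open>t *\<^sub>R (X *v x)\<close> under the unitary flow,
  which commutes with \<open>X\<close>; by invariance the integrand is constant.\<close>

lemma finsler_length_flow:
  assumes "0 \<le> t"
  shows "finsler_length (randers_fun a b c) (\<lambda>\<tau>. flow (\<tau> * t) x) = t * randers_fun a b c x (X *v x)"
proof -
  have "vector_derivative (\<lambda>\<tau>. flow (\<tau> * t) x) (at \<tau>) = t *\<^sub>R flow (\<tau> * t) (X *v x)" for \<tau>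
    using vector_derivative_at[OF flow_has_vector_derivative_scaled] by (simp add: X_flow)
  then have "randers_fun a b c (flow (\<tau> * t) x) (vector_derivative (\<lambda>\<tau>. flow (\<tau> * t) x) (at \<tau>))
      = t * randers_fun a b c x (X *v x)" for \<tau>
    using assms unitary_randers_fun[OF unitary_matrix_exp]
    by (simp add: randers_fun_scaleR) (simp add: matrix_exp_flow)
  then show ?thesis by (simp add: finsler_length_def)
qed

lemma inner_X_X:
  assumes "norm x = 1"
  shows "(X *v x) \<bullet> (X *v x) = (\<mu>1 + \<mu>2) * ((\<i> *s x) \<bullet> (X *v x)) - \<mu>1 * \<mu>2"
proof -
  have "x \<bullet> x = 1" using assms by (simp add: norm_eq_1)
  then have "(X *v x) \<bullet> (X *v x) = - ((\<mu>1 + \<mu>2) * (x \<bullet> (\<i> *s (X *v x))) + \<mu>1 * \<mu>2)"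
    unfolding skew_hermitian_inner[OF skew] quadratic by (simp add: inner_add_right)
  then show ?thesis using inner_imult_left[of x "X *v x"] by simp
qed

end

section \<open>The solution metric and its minimizing orbits\<close>

locale opposite_signs = skew_quadratic X \<mu>1 \<mu>2
  for X :: "complex ^ 'm ^ 'm" and \<mu>1 \<mu>2 :: real +
  assumes opposite: "\<mu>1 * \<mu>2 < 0"
begin

text \<open>Both constants come from comparing coefficients of \<open>s\<close> in the equation of
  constant length with \<open>a = 1\<close>: the constant term gives
  \<open>k\<^sup>2 = - \<mu>1 \<mu>2\<close>, the linear term \<open>c * k = - m\<close>.\<close>

definition k where "k = sqrt (- (\<mu>1 * \<mu>2))"
definition c where "c = - m / k"

lemma k_pos: "0 < k" using opposite by (simp add: k_def)

lemma c_k: "c * k = - m" using k_pos by (simp add: c_def)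

lemma k_squared: "k\<^sup>2 = - (\<mu>1 * \<mu>2)" using opposite by (simp add: k_def)

text \<open>Speeds match: \<open>F\<close>-speed \<open>k\<close> becomes round speed
  \<open>sqrt (1 + c\<^sup>2) * k\<close> in the moving frame, which has to be the speed of the
  great circles generated by \<open>\<delta> J\<close>.\<close>

lemma sqrt_c_k: "sqrt (1 + c\<^sup>2) * k = \<bar>\<delta>\<bar>"
proof -
  have "(sqrt (1 + c\<^sup>2) * k)\<^sup>2 = k\<^sup>2 + (c * k)\<^sup>2"
    unfolding power_mult_distrib by (subst real_sqrt_pow2) (simp_all add: algebra_simps)
  also have "\<dots> = \<bar>\<delta>\<bar>\<^sup>2"
    unfolding c_k k_squared by (simp add: m_def \<delta>_def power2_eq_square field_simps)
  finally show ?thesis by (rule power2_eq_imp_eq) (use k_pos in simp_all)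
qed

lemma constant_length:
  assumes "norm x = 1" shows "randers_fun 1 (c\<^sup>2) c x (X *v x) = k"
proof -
  define s where "s = (\<i> *s x) \<bullet> (X *v x)"
  have "k * (c * s) = - m * s" using c_k by (simp add: algebra_simps)
  then have "(X *v x) \<bullet> (X *v x) + c\<^sup>2 * s\<^sup>2 = (k - c * s)\<^sup>2"
    unfolding inner_X_X[OF assms] s_def[symmetric]
    by (simp add: power2_diff k_squared power_mult_distrib m_def algebra_simps)
  then have F: "sqrt ((X *v x) \<bullet> (X *v x) + c\<^sup>2 * s\<^sup>2) = \<bar>k - c * s\<bar>" by simp
  \<comment> \<open>This settles the sign: if \<open>k < c * s\<close>, then
    \<open>\<bar>k - c * s\<bar>\<close> would be smaller than \<open>c * s\<close>.\<close>
  have "\<bar>c * s\<bar> \<le> sqrt ((X *v x) \<bullet> (X *v x) + c\<^sup>2 * s\<^sup>2)"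
    by (rule real_le_rsqrt) (simp add: power_mult_distrib)
  then have "\<bar>k - c * s\<bar> = k - c * s" using F k_pos by linarith
  then show ?thesis using F by (simp add: randers_fun_def s_def)
qed

text \<open>A competitor shorter by \<open>\<epsilon>\<close> covers an angle of at most
  \<open>R * L = \<theta> - R * \<epsilon>\<close> in the moving frame, but its target there is at
  angle at least \<open>\<theta> - \<bar>c\<bar> * \<epsilon>\<close> from \<open>x\<close>. Since
  \<open>\<bar>c\<bar> < R\<close>, this is impossible.\<close>

lemma finsler_length_ge:
  assumes x: "norm x = 1" and t: "0 \<le> t" "\<bar>\<delta>\<bar> * t \<le> pi"
    and \<gamma>: "piecewise_smooth_curve \<gamma>" "\<gamma> ` {0..1} \<subseteq> usphere" "\<gamma> 0 = x" "\<gamma> 1 = flow t x"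
  shows "t * k \<le> finsler_length (randers_fun 1 (c\<^sup>2) c) \<gamma>"
proof (rule ccontr)
  define L where "L = finsler_length (randers_fun 1 (c\<^sup>2) c) \<gamma>"
  define R where "R = sqrt (1 + c\<^sup>2)"
  define \<theta> where "\<theta> = \<bar>\<delta>\<bar> * t"
  define \<epsilon> where "\<epsilon> = t * k - L"
  assume "\<not> t * k \<le> finsler_length (randers_fun 1 (c\<^sup>2) c) \<gamma>"
  then have \<epsilon>: "0 < \<epsilon>" by (simp add: \<epsilon>_def L_def)
  have Rc: "\<bar>c\<bar> < R" unfolding R_def by (rule real_less_rsqrt) simp
  have R0: "0 < R" using Rc by linarith
  have R\<theta>: "R * (t * k) = \<theta>" using sqrt_c_k by (simp add: R_def \<theta>_def mult.left_commute mult.commute)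
  then have RL: "R * L = \<theta> - R * \<epsilon>" by (simp add: \<epsilon>_def algebra_simps)
  then have "R * L \<le> pi" using t(2) mult_pos_pos[OF R0 \<epsilon>] unfolding \<theta>_def by linarith
  from zermelo_lower_bound[OF \<gamma>(1,2) L_def this[unfolded R_def]]
  have L0: "0 \<le> L" and cos_le: "cos (R * L) \<le> x \<bullet> (cis (c * L) *s flow t x)"
    by (simp_all add: R_def \<gamma>)
  \<comment> \<open>By \<open>c * k = - m\<close>, a rotation timed by the full length
    \<open>t * k\<close> would undo the phase \<open>cis (m * t)\<close> exactly; only the defect
    \<open>\<epsilon>\<close> is left.\<close>
  have "c * L + m * t = - (c * \<epsilon>)" using c_k by (simp add: \<epsilon>_def algebra_simps)
  then have "cis (c * L) *s flow t x = cis (- (c * \<epsilon>)) *s (cos (\<delta> * t) *\<^sub>R x + sin (\<delta> * t) *\<^sub>R J x)"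
    unfolding flow_def vector_smult_assoc cis_mult by simp
  then have "x \<bullet> (cis (c * L) *s flow t x) = (cis (c * \<epsilon>) *s x) \<bullet> (cos (\<delta> * t) *\<^sub>R x + sin (\<delta> * t) *\<^sub>R J x)"
    by (simp add: inner_smult_left cis_cnj)
  also have "cis (c * \<epsilon>) *s x = cos (c * \<epsilon>) *\<^sub>R x + sin (c * \<epsilon>) *\<^sub>R (\<i> *s x)"
    by (simp add: vec_eq_iff complex_eq_iff algebra_simps)
  also have "\<dots> \<bullet> (cos (\<delta> * t) *\<^sub>R x + sin (\<delta> * t) *\<^sub>R J x)
      = cos (c * \<epsilon>) * cos (\<delta> * t) + sin (c * \<epsilon>) * sin (\<delta> * t) * ((\<i> *s x) \<bullet> J x)"
    using x by (simp add: inner_add norm_eq_1)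
  \<comment> \<open>The number \<open>(\<i> *s x) \<bullet> J x\<close> lies between -1 and 1. The
    worst case of it and of the signs is a cosine of a difference of angles, where the great circle
    runs along the Hopf fibre.\<close>
  also have "\<dots> \<le> cos (\<bar>c\<bar> * \<epsilon>) * cos \<theta> + sin (\<bar>c\<bar> * \<epsilon>) * sin \<theta>"
  proof -
    have c\<epsilon>: "\<bar>c\<bar> * \<epsilon> \<le> pi"
    proof -
      have "\<bar>c\<bar> * \<epsilon> \<le> R * \<epsilon>" using Rc \<epsilon> by (intro mult_right_mono) auto
      also have "\<dots> \<le> \<theta>" using RL L0 R0 mult_nonneg_nonneg[of R L] by linarith
      finally show ?thesis using t by (simp add: \<theta>_def)
    qed
    have sin_abs: "\<bar>sin y\<bar> = sin \<bar>y\<bar>" if "\<bar>y\<bar> \<le> pi" for y :: real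
      using sin_ge_zero[of "\<bar>y\<bar>"] that by (cases "0 \<le> y") auto
    have "\<bar>sin (c * \<epsilon>)\<bar> = sin (\<bar>c\<bar> * \<epsilon>)"
      using sin_abs[of "c * \<epsilon>"] c\<epsilon> \<epsilon> by (simp add: abs_mult)
    moreover have "\<bar>sin (\<delta> * t)\<bar> = sin \<theta>"
      using sin_abs[of "\<delta> * t"] t by (simp add: abs_mult \<theta>_def)
    moreover have "\<bar>(\<i> *s x) \<bullet> J x\<bar> \<le> 1"
      using Cauchy_Schwarz_ineq2[of "\<i> *s x" "J x"] x by (simp add: norm_smult)
    moreover have "sin (c * \<epsilon>) * sin (\<delta> * t) * ((\<i> *s x) \<bullet> J x)
        \<le> \<bar>sin (c * \<epsilon>)\<bar> * \<bar>sin (\<delta> * t)\<bar> * \<bar>(\<i> *s x) \<bullet> J x\<bar>"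
      unfolding abs_mult[symmetric] by (rule abs_ge_self)
    moreover have "\<bar>sin (c * \<epsilon>)\<bar> * \<bar>sin (\<delta> * t)\<bar> * \<bar>(\<i> *s x) \<bullet> J x\<bar> \<le> \<bar>sin (c * \<epsilon>)\<bar> * \<bar>sin (\<delta> * t)\<bar>"
      by (rule mult_left_le) (use calculation(3) in simp_all)
    moreover have "cos (c * \<epsilon>) = cos (\<bar>c\<bar> * \<epsilon>)" "cos (\<delta> * t) = cos \<theta>"
      by (cases "0 \<le> c"; simp) (cases "0 \<le> \<delta>"; simp add: \<theta>_def)
    ultimately show ?thesis by simp
  qed
  also have "\<dots> = cos (\<theta> - \<bar>c\<bar> * \<epsilon>)" by (simp add: cos_diff)
  also have "\<dots> < cos (R * L)"
  proof (rule cos_monotone_0_pi)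
    show "0 \<le> R * L" using L0 R0 by simp
    show "R * L < \<theta> - \<bar>c\<bar> * \<epsilon>" using Rc \<epsilon> by (simp add: RL)
    show "\<theta> - \<bar>c\<bar> * \<epsilon> \<le> pi" using t \<epsilon> by (simp add: \<theta>_def) (smt (verit) mult_nonneg_nonneg)
  qed
  finally show False using cos_le by simp
qed

lemma finsler_dist_flow:
  assumes x: "norm x = 1" and t: "0 \<le> t" "\<bar>\<delta>\<bar> * t \<le> pi"
  shows "finsler_dist (randers_fun 1 (c\<^sup>2) c) x (flow t x) = t * k"
  unfolding finsler_dist_def
proof (rule cInf_eq_minimum)
  let ?\<Gamma> = "{\<gamma>. piecewise_smooth_curve \<gamma> \<and> \<gamma> ` {0..1} \<subseteq> usphere \<and> \<gamma> 0 = x \<and> \<gamma> 1 = flow t x}"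
  have "(\<lambda>\<tau>. flow (\<tau> * t) x) \<in> ?\<Gamma>" using piecewise_smooth_flow x by auto
  moreover have "t * k = finsler_length (randers_fun 1 (c\<^sup>2) c) (\<lambda>\<tau>. flow (\<tau> * t) x)"
    by (simp add: finsler_length_flow t constant_length[OF x])
  ultimately show "t * k \<in> finsler_length (randers_fun 1 (c\<^sup>2) c) ` ?\<Gamma>" by blast
  show "t * k \<le> y" if "y \<in> finsler_length (randers_fun 1 (c\<^sup>2) c) ` ?\<Gamma>" for y
    using that finsler_length_ge[OF x t] by auto
qed

lemma unitary_invariant_randers_fun: "unitary_invariant (randers_fun a b c)"
  by (simp add: unitary_invariant_def unitary_randers_fun)

lemma generates_CW_translations: "generates_CW_translations (randers_fun 1 (c\<^sup>2) c) X"
  unfolding generates_CW_translations_def eventually_at_right_field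
proof (intro exI[of _ "pi / \<bar>\<delta>\<bar>"] conjI allI impI)
  show "0 < pi / \<bar>\<delta>\<bar>" using \<delta>_nonzero by simp
  \<comment> \<open>Before the time \<open>pi / \<bar>\<delta>\<bar>\<close> the great circle has
    not yet reached the antipode.\<close>
  fix t :: real assume t: "0 < t" "t < pi / \<bar>\<delta>\<bar>"
  then have t': "\<bar>\<delta>\<bar> * t \<le> pi" using \<delta>_nonzero by (simp add: field_simps)
  show "CW_translation (randers_fun 1 (c\<^sup>2) c) ((*v) (matrix_exp (t *\<^sub>R X)))"
    unfolding CW_translation_def
  proof (intro conjI exI[of _ "t * k"] ballI)
    show "finsler_isometry (randers_fun 1 (c\<^sup>2) c) ((*v) (matrix_exp (t *\<^sub>R X)))"
      by (intro finsler_isometry_unitary unitary_matrix_exp unitary_invariant_randers_fun)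
    fix x :: "complex ^ 'm" assume "x \<in> usphere"
    then show "finsler_dist (randers_fun 1 (c\<^sup>2) c) x (matrix_exp (t *\<^sub>R X) *v x) = t * k"
      using finsler_dist_flow[OF _ _ t'] t by (simp add: matrix_exp_flow)
  qed
qed

text \<open>The Hopf component of \<open>v\<close> is at most its norm, so \<open>g x v v\<close> is
  at least \<open>1 + c\<^sup>2\<close> times the square of that component. This bounds the length
  of \<open>\<beta>\<close> by \<open>\<bar>c\<bar> / sqrt (1 + c\<^sup>2)\<close>, and the
  assumption makes \<open>c\<close> nonzero.\<close>

lemma nonriemannian_randers:
  assumes "\<mu>1 + \<mu>2 \<noteq> 0"
  shows "nonriemannian_randers (randers_fun 1 (c\<^sup>2) c :: complex ^ 'm \<Rightarrow> _)"
proof -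
  define g where "g x u v = u \<bullet> v + c\<^sup>2 * (((\<i> *s x) \<bullet> u) * ((\<i> *s x) \<bullet> v))" for x u v :: "complex ^ 'm"
  define \<beta> where "\<beta> x v = c * ((\<i> *s x) \<bullet> v)" for x v :: "complex ^ 'm"
  have sm: "smooth_on usphere (\<lambda>x. (\<i> *s x) \<bullet> V x)" if "smooth_vector_field V" for V :: "complex ^ 'm \<Rightarrow> _"
    using that unfolding smooth_vector_field_def
    by (intro smooth_on_bilinear[OF bounded_bilinear_inner] smooth_on_bounded_linear[OF bounded_linear_smult]) simp
  have "riemannian_metric g"
    unfolding riemannian_metric_def
  proof (intro conjI ballI allI impI)
    show "g x u v = g x v u" for x u v by (simp add: g_def inner_commute[of u] mult.commute)
    show "g x (a *\<^sub>R u + b *\<^sub>R v) w = a * g x u w + b * g x v w" for x u v w a b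
      by (simp add: g_def inner_add algebra_simps)
    show "0 < g x v v" if "v \<noteq> 0" for x v
      using that by (simp add: g_def add_pos_nonneg)
    fix V W :: "complex ^ 'm \<Rightarrow> complex ^ 'm"
    assume VW: "smooth_vector_field V" "smooth_vector_field W"
    then show "smooth_on usphere (\<lambda>x. g x (V x) (W x))"
      unfolding g_def smooth_vector_field_def
      by (intro smooth_on_add smooth_on_bilinear[OF bounded_bilinear_inner]
          smooth_on_bilinear[OF bounded_bilinear_mult] smooth_on_const sm[OF VW(1)] sm[OF VW(2)]) auto
  qed
  moreover have "smooth_one_form \<beta>"
    unfolding smooth_one_form_def \<beta>_def
    by (auto simp: inner_add algebra_simps intro!: smooth_on_bilinear[OF bounded_bilinear_mult] sm)
  moreover have "covector_length g \<beta> x < 1" if "x \<in> usphere" for x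
  proof -
    have "covector_length g \<beta> x \<le> \<bar>c\<bar> / sqrt (1 + c\<^sup>2)"
      unfolding covector_length_def
    proof (rule cSUP_least)
      show "{v \<in> tsp x. g x v v \<le> 1} \<noteq> {}"
        by (auto simp: tsp_def g_def intro!: exI[of _ 0])
      fix v assume v: "v \<in> {v \<in> tsp x. g x v v \<le> 1}"
      have "((\<i> *s x) \<bullet> v)\<^sup>2 * (1 + c\<^sup>2) \<le> 1"
        using v inner_imult_bound[of x v] that by (simp add: g_def power2_eq_square algebra_simps)
      then have "((\<i> *s x) \<bullet> v)\<^sup>2 \<le> 1 / (1 + c\<^sup>2)" by (simp add: field_simps add_pos_nonneg)
      then have "\<bar>(\<i> *s x) \<bullet> v\<bar> \<le> 1 / sqrt (1 + c\<^sup>2)"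
        using real_sqrt_le_mono by (fastforce simp: real_sqrt_divide)
      then show "\<bar>\<beta> x v\<bar> \<le> \<bar>c\<bar> / sqrt (1 + c\<^sup>2)"
        using mult_left_mono[of _ _ "\<bar>c\<bar>"] by (fastforce simp: \<beta>_def abs_mult)
    qed
    moreover have "\<bar>c\<bar> < sqrt (1 + c\<^sup>2)" by (rule real_less_rsqrt) simp
    then have "\<bar>c\<bar> / sqrt (1 + c\<^sup>2) < 1" by (intro divide_less_eq_1_pos[THEN iffD2]) linarith+
    ultimately show ?thesis by linarith
  qed
  ultimately have "randers_pair (randers_fun 1 (c\<^sup>2) c) g \<beta>"
    unfolding randers_pair_def by (simp add: randers_fun_def g_def \<beta>_def power2_eq_square)
  moreover have "\<exists>x\<in>usphere. \<exists>v\<in>tsp x. \<beta> x v \<noteq> 0"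
  proof -
    obtain x :: "complex ^ 'm" where x: "norm x = 1" by (metis vector_choose_size zero_le_one)
    have "\<beta> x (\<i> *s x) = c" using x by (simp add: \<beta>_def norm_eq_1)
    moreover have "c \<noteq> 0" using assms k_pos by (simp add: c_def m_def)
    ultimately show ?thesis using x by (intro bexI[of _ x] bexI[of _ "\<i> *s x"]) (auto simp: tsp_def)
  qed
  ultimately show ?thesis unfolding nonriemannian_randers_def by blast
qed

end

section \<open>Infinitesimal displacement\<close>

text \<open>On the unit Hopf vector the Riemannian part has square \<open>a + b\<close> and the
  one-form has value \<open>c\<close>; the second condition is thus the length bound on the
  one-form. The coefficient \<open>b\<close> may be negative.\<close>

locale randers_coefficients =
  fixes a b c :: real
  assumes a_pos: "0 < a" and c_less: "\<bar>c\<bar> < sqrt (a + b)"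
begin

text \<open>A linear map turning the Riemannian part of the metric at \<open>x\<close> into an
  ordinary norm, so that Cauchy-Schwarz and the triangle inequality become available. The components
  are the part orthogonal to the Hopf vector and the Hopf coordinate.\<close>

definition embed :: "complex ^ 'm \<Rightarrow> complex ^ 'm \<Rightarrow> (complex ^ 'm) \<times> real" where
  "embed x v = (sqrt a *\<^sub>R (v - ((\<i> *s x) \<bullet> v) *\<^sub>R (\<i> *s x)), sqrt (a + b) * ((\<i> *s x) \<bullet> v))"

lemma ab_pos: "0 < a + b"
  using c_less by (metis abs_ge_zero le_less_trans real_sqrt_gt_0_iff)

lemma linear_embed: "linear (embed x)"
  by (rule linearI) (simp_all add: embed_def inner_add algebra_simps)

lemma norm_embed_squared:
  assumes "norm x = 1"
  shows "(norm (embed x v))\<^sup>2 = a * (v \<bullet> v - ((\<i> *s x) \<bullet> v)\<^sup>2) + (a + b) * ((\<i> *s x) \<bullet> v)\<^sup>2"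
proof -
  define s where "s = (\<i> *s x) \<bullet> v"
  have s: "(\<i> *s x) \<bullet> v = s" "v \<bullet> (\<i> *s x) = s" by (simp_all add: s_def inner_commute)
  have xx: "x \<bullet> x = 1" using assms by (simp add: norm_eq_1)
  have "(v - s *\<^sub>R (\<i> *s x)) \<bullet> (v - s *\<^sub>R (\<i> *s x)) = v \<bullet> v - s\<^sup>2"
    by (simp add: inner_diff s xx power2_eq_square)
  moreover have "sqrt a * (sqrt a * y) = a * y" "sqrt (a + b) * s * (sqrt (a + b) * s) = (a + b) * s\<^sup>2" for y
    using a_pos ab_pos by (simp_all add: power2_eq_square mult.assoc[symmetric])
  ultimately show ?thesis
    unfolding power2_norm_eq_inner embed_def s using a_pos by simp
qed

lemma norm_embed:
  assumes "norm x = 1"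
  shows "norm (embed x v) = sqrt (a * (v \<bullet> v) + b * ((\<i> *s x) \<bullet> v)\<^sup>2)"
proof -
  have "norm (embed x v) = sqrt ((norm (embed x v))\<^sup>2)" by simp
  then show ?thesis unfolding norm_embed_squared[OF assms] by (simp add: algebra_simps)
qed

lemma randers_fun_embed:
  "norm x = 1 \<Longrightarrow> randers_fun a b c x v = norm (embed x v) + c * ((\<i> *s x) \<bullet> v)"
  by (simp add: randers_fun_def norm_embed)

text \<open>The second factor compares the Riemannian part with the Euclidean norm; the first is the
  fraction of it that a one-form of length \<open>\<bar>c\<bar> / sqrt (a + b)\<close> must
  leave.\<close>

definition lower where
  "lower = (1 - \<bar>c\<bar> / sqrt (a + b)) * sqrt (min a (a + b))"

lemma lower_pos: "0 < lower"
proof -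
  have "\<bar>c\<bar> / sqrt (a + b) < 1" using c_less ab_pos by simp
  then show ?thesis using a_pos ab_pos by (simp add: lower_def)
qed

lemma randers_fun_lower:
  assumes "norm x = 1"
  shows "lower * norm v \<le> randers_fun a b c x v"
proof -
  define s where "s = (\<i> *s x) \<bullet> v"
  have r: "\<bar>c\<bar> / sqrt (a + b) < 1" using c_less ab_pos by simp
  have "s\<^sup>2 \<le> v \<bullet> v" unfolding s_def by (rule inner_imult_bound[OF assms])
  then have "min a (a + b) * (v \<bullet> v - s\<^sup>2) + min a (a + b) * s\<^sup>2 \<le> (norm (embed x v))\<^sup>2"
    unfolding norm_embed_squared[OF assms] s_def[symmetric]
    by (intro add_mono mult_right_mono) auto
  then have "(sqrt (min a (a + b)) * norm v)\<^sup>2 \<le> (norm (embed x v))\<^sup>2"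
    using a_pos ab_pos by (simp add: power_mult_distrib power2_norm_eq_inner algebra_simps)
  then have min: "sqrt (min a (a + b)) * norm v \<le> norm (embed x v)"
    by (rule power2_le_imp_le) simp
  have "sqrt (a + b) * \<bar>s\<bar> \<le> norm (embed x v)"
    using norm_snd_le[of "snd (embed x v)" "fst (embed x v)"] ab_pos by (simp add: embed_def s_def abs_mult)
  then have "\<bar>c\<bar> / sqrt (a + b) * (sqrt (a + b) * \<bar>s\<bar>) \<le> \<bar>c\<bar> / sqrt (a + b) * norm (embed x v)"
    using ab_pos by (intro mult_left_mono) auto
  then have "\<bar>c * s\<bar> \<le> \<bar>c\<bar> / sqrt (a + b) * norm (embed x v)"
    using ab_pos by (simp add: abs_mult)
  moreover have "lower * norm v \<le> (1 - \<bar>c\<bar> / sqrt (a + b)) * norm (embed x v)"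
    unfolding lower_def mult.assoc using r min by (intro mult_left_mono) auto
  ultimately show ?thesis
    unfolding randers_fun_embed[OF assms] s_def[symmetric] by (simp add: algebra_simps)
qed

text \<open>Contributions to the change of the metric with the base point: twice
  \<open>sqrt a\<close>, since both the Hopf vector and the coordinate along it move,
  \<open>sqrt (a + b)\<close> from the Hopf coordinate, and \<open>\<bar>c\<bar>\<close> from the
  one-form.\<close>

definition lip where "lip = 2 * sqrt a + sqrt (a + b) + \<bar>c\<bar>"

lemma lip_nonneg: "0 \<le> lip" using a_pos ab_pos by (simp add: lip_def)

lemma randers_fun_lipschitz:
  assumes x: "norm x = 1" and y: "norm y = 1"
  shows "randers_fun a b c x v \<le> randers_fun a b c y v + lip * norm (y - x) * norm v"
proof -
  define s r where "s = (\<i> *s x) \<bullet> v" and "r = (\<i> *s y) \<bullet> v"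
  have dI: "\<i> *s (y - x) = \<i> *s y - \<i> *s x" by (simp add: vec_eq_iff algebra_simps)
  have rs_eq: "r - s = (\<i> *s (y - x)) \<bullet> v" unfolding dI by (simp add: r_def s_def inner_diff)
  then have rs: "\<bar>r - s\<bar> \<le> norm (y - x) * norm v"
    using Cauchy_Schwarz_ineq2[of "\<i> *s (y - x)" v] unfolding rs_eq norm_smult by simp
  have s: "\<bar>s\<bar> \<le> norm v"
    using Cauchy_Schwarz_ineq2[of "\<i> *s x" v] x by (simp add: norm_smult s_def)
  have "norm (r *\<^sub>R (\<i> *s y) - s *\<^sub>R (\<i> *s x)) = norm ((r - s) *\<^sub>R (\<i> *s y) + s *\<^sub>R (\<i> *s (y - x)))"
    unfolding dI by (simp add: algebra_simps)
  also have "\<dots> \<le> \<bar>r - s\<bar> * 1 + \<bar>s\<bar> * norm (y - x)"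
    using norm_triangle_ineq[of "(r - s) *\<^sub>R (\<i> *s y)" "s *\<^sub>R (\<i> *s (y - x))"] y
    unfolding norm_scaleR norm_smult by simp
  also have "\<dots> \<le> norm (y - x) * norm v * 1 + norm v * norm (y - x)"
    using rs s by (intro add_mono mult_right_mono) auto
  finally have rs2: "norm (r *\<^sub>R (\<i> *s y) - s *\<^sub>R (\<i> *s x)) \<le> 2 * (norm (y - x) * norm v)"
    by (simp add: mult.commute)
  have "embed x v - embed y v = (sqrt a *\<^sub>R (r *\<^sub>R (\<i> *s y) - s *\<^sub>R (\<i> *s x)), sqrt (a + b) * (s - r))"
    by (simp add: embed_def s_def r_def algebra_simps)
  then have "norm (embed x v - embed y v) \<le> norm (sqrt a *\<^sub>R (r *\<^sub>R (\<i> *s y) - s *\<^sub>R (\<i> *s x))) + norm (sqrt (a + b) * (s - r))"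
    by (simp only: norm_Pair_le)
  also have "\<dots> = sqrt a * norm (r *\<^sub>R (\<i> *s y) - s *\<^sub>R (\<i> *s x)) + sqrt (a + b) * \<bar>r - s\<bar>"
    using a_pos ab_pos by (simp add: abs_mult abs_minus_commute)
  also have "\<dots> \<le> sqrt a * (2 * (norm (y - x) * norm v)) + sqrt (a + b) * (norm (y - x) * norm v)"
    using rs rs2 a_pos ab_pos by (intro add_mono mult_left_mono) auto
  finally have "norm (embed x v) \<le> norm (embed y v)
      + (sqrt a * (2 * (norm (y - x) * norm v)) + sqrt (a + b) * (norm (y - x) * norm v))"
    using norm_triangle_ineq2[of "embed x v" "embed y v"] by linarith
  moreover have "c * s - c * r \<le> \<bar>c\<bar> * (norm (y - x) * norm v)"
  proof -
    have "c * s - c * r \<le> \<bar>c\<bar> * \<bar>r - s\<bar>"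
      using abs_ge_self[of "c * (s - r)"] unfolding abs_mult abs_minus_commute[of r s]
      by (simp add: right_diff_distrib)
    also have "\<dots> \<le> \<bar>c\<bar> * (norm (y - x) * norm v)" using rs by (intro mult_left_mono) auto
    finally show ?thesis .
  qed
  ultimately show ?thesis
    unfolding randers_fun_embed[OF x] randers_fun_embed[OF y] s_def[symmetric] r_def[symmetric] lip_def
    by (simp add: algebra_simps)
qed

text \<open>The differential of the metric at \<open>x\<close> in the direction \<open>u\<close>,
  applied to \<open>v\<close>: a linear functional below the metric that touches it at
  \<open>u\<close>. If \<open>embed x u\<close> vanishes, the quotient is 0 and both properties
  persist.\<close>

definition support where
  "support x u v = (embed x u \<bullet> embed x v) / norm (embed x u) + c * ((\<i> *s x) \<bullet> v)"

lemma linear_support: "linear (support x u)"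
  by (rule linearI)
    (simp_all add: support_def linear_add[OF linear_embed] linear_cmul[OF linear_embed] inner_add_right
      add_divide_distrib algebra_simps)

lemma support_le:
  assumes "norm x = 1"
  shows "support x u v \<le> randers_fun a b c x v"
proof -
  have "(embed x u \<bullet> embed x v) / norm (embed x u) \<le> norm (embed x v)"
    using norm_cauchy_schwarz[of "embed x u" "embed x v"]
    by (cases "norm (embed x u) = 0") (auto simp: field_simps)
  then show ?thesis by (simp add: support_def randers_fun_embed[OF assms])
qed

lemma support_self:
  assumes "norm x = 1"
  shows "support x u u = randers_fun a b c x u"
  by (simp add: support_def randers_fun_embed[OF assms] power2_norm_eq_inner[symmetric] power2_eq_square)

lemma randers_fun_nonneg: "norm x = 1 \<Longrightarrow> 0 \<le> randers_fun a b c x v"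
  using randers_fun_lower[of x v] lower_pos by (meson mult_nonneg_nonneg norm_ge_zero order_trans less_imp_le)

text \<open>A curve of \<open>F\<close>-length \<open>L\<close> stays within Euclidean distance \<open>L / lower\<close> of its starting point, so
  freezing the base point of \<open>F\<close> there costs only a term quadratic in \<open>L\<close>.\<close>

lemma support_le_length:
  fixes \<gamma> :: "real \<Rightarrow> complex ^ 'm"
  assumes \<gamma>: "piecewise_smooth_curve \<gamma>" "\<gamma> ` {0..1} \<subseteq> usphere"
    and L: "L = finsler_length (randers_fun a b c) \<gamma>"
  shows "0 \<le> L" "support (\<gamma> 0) u (\<gamma> 1 - \<gamma> 0) \<le> L + lip * (L / lower)\<^sup>2"
proof -
  define x where "x = \<gamma> 0"
  define \<gamma>' where "\<gamma>' t = vector_derivative \<gamma> (at t)" for t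
  define f where "f t = randers_fun a b c (\<gamma> t) (\<gamma>' t)" for t
  from \<gamma>(1) obtain K where K: "finite K" and cont: "continuous_on {0..1} \<gamma>"
    and der: "\<And>t. t \<in> {0<..<1} - K \<Longrightarrow> (\<gamma> has_vector_derivative \<gamma>' t) (at t)"
    and int: "\<And>\<Phi>. continuous_on UNIV (\<lambda>(x, v). \<Phi> x v) \<Longrightarrow> (\<lambda>t. \<Phi> (\<gamma> t) (\<gamma>' t) :: real) integrable_on {0..1}"
    unfolding \<gamma>'_def by (rule piecewise_smooth_curveE) blast
  have norm_\<gamma>: "norm (\<gamma> t) = 1" if "t \<in> {0..1}" for t
    using that \<gamma>(2) by force
  have x: "norm x = 1" using norm_\<gamma>[of 0] by (simp add: x_def)
  have f_int: "(f has_integral L) {0..1}"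
    using integrable_integral[OF int[OF continuous_randers_fun[of a b c]]]
    unfolding f_def[abs_def] L finsler_length_def \<gamma>'_def[symmetric] .
  show "0 \<le> L"
    using has_integral_nonneg[OF f_int] randers_fun_nonneg norm_\<gamma> unfolding f_def by blast
  have n_int: "(\<lambda>t. norm (\<gamma>' t)) integrable_on {0..1}"
    by (rule int) (auto simp: case_prod_unfold intro!: continuous_intros)
  define E where "E = integral {0..1} (\<lambda>t. norm (\<gamma>' t))"
  have E_int: "((\<lambda>t. norm (\<gamma>' t)) has_integral E) {0..1}"
    using n_int unfolding E_def by (rule integrable_integral)
  have E0: "0 \<le> E" by (rule has_integral_nonneg[OF E_int]) simp
  have "lower * E \<le> L"
    by (rule has_integral_le[OF has_integral_mult_right[OF E_int] f_int])
      (simp add: f_def randers_fun_lower norm_\<gamma>)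
  then have EL: "E \<le> L / lower" using lower_pos by (simp add: field_simps)
  have dist: "norm (\<gamma> t - x) \<le> E" if t: "t \<in> {0..1}" for t
  proof -
    have "(\<gamma>' has_integral (\<gamma> t - \<gamma> 0)) {0..t}"
      using t der by (intro fundamental_theorem_of_calculus_interior_strong[OF K] continuous_on_subset[OF cont]) auto
    moreover have sub: "(\<lambda>t. norm (\<gamma>' t)) integrable_on {0..t}"
      using integrable_on_subinterval[OF n_int] t by auto
    ultimately have "norm (\<gamma> t - \<gamma> 0) \<le> integral {0..t} (\<lambda>t. norm (\<gamma>' t))"
      using integral_norm_bound_integral[of \<gamma>' "{0..t}" "\<lambda>t. norm (\<gamma>' t)"] by (auto simp: has_integral_iff)
    also have "\<dots> \<le> E"
      unfolding E_def using t by (intro integral_subset_le sub n_int) auto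
    finally show ?thesis by (simp add: x_def)
  qed
  have bl: "bounded_linear (support x u)"
    using linear_support by (simp add: linear_conv_bounded_linear)
  have "((\<lambda>t. support x u (\<gamma>' t)) has_integral (support x u (\<gamma> 1) - support x u (\<gamma> 0))) {0..1}"
    by (intro fundamental_theorem_of_calculus_interior_strong[OF K] bounded_linear.has_vector_derivative[OF bl]
        bounded_linear.continuous_on[OF bl] cont der) auto
  \<comment> \<open>Freezing the base point costs \<open>lip * E\<close> times the Euclidean speed,
    whose integral is again \<open>E\<close>: hence the quadratic error.\<close>
  moreover have "((\<lambda>t. f t + lip * E * norm (\<gamma>' t)) has_integral (L + lip * E * E)) {0..1}"
    by (intro has_integral_add f_int has_integral_mult_right E_int)
  moreover have "support x u (\<gamma>' t) \<le> f t + lip * E * norm (\<gamma>' t)" if t: "t \<in> {0..1}" for t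
  proof -
    have "support x u (\<gamma>' t) \<le> randers_fun a b c x (\<gamma>' t)" by (rule support_le[OF x])
    also have "\<dots> \<le> f t + lip * norm (\<gamma> t - x) * norm (\<gamma>' t)"
      unfolding f_def by (rule randers_fun_lipschitz[OF x norm_\<gamma>[OF t]])
    also have "\<dots> \<le> f t + lip * E * norm (\<gamma>' t)"
      using dist[OF t] lip_nonneg by (intro add_left_mono mult_right_mono mult_left_mono) auto
    finally show ?thesis .
  qed
  ultimately have "support x u (\<gamma> 1) - support x u (\<gamma> 0) \<le> L + lip * E * E"
    by (rule has_integral_le)
  also have "\<dots> \<le> L + lip * (L / lower)\<^sup>2"
    using EL E0 lip_nonneg unfolding power2_eq_square mult.assoc
    by (intro add_left_mono mult_left_mono mult_mono) auto
  finally show "support (\<gamma> 0) u (\<gamma> 1 - \<gamma> 0) \<le> L + lip * (L / lower)\<^sup>2"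
    by (simp add: linear_diff[OF linear_support] x_def)
qed

end

text \<open>A sandwich: the orbit itself gives \<open>t * A\<close> from above. From below the
  supporting functional gives \<open>S t\<close> up to an error of order \<open>t\<^sup>2\<close>,
  and \<open>S t / t\<close> tends to its value at \<open>X *v x\<close>, which is
  \<open>A\<close>.\<close>

lemma (in skew_quadratic) tendsto_finsler_dist_flow:
  assumes "randers_coefficients a b c" and x: "norm x = 1"
  shows "((\<lambda>t. finsler_dist (randers_fun a b c) x (flow t x) / t) \<longlongrightarrow> randers_fun a b c x (X *v x)) (at_right 0)"
proof -
  interpret randers_coefficients a b c by fact
  define A where "A = randers_fun a b c x (X *v x)"
  define \<Gamma> where "\<Gamma> t = {\<gamma>. piecewise_smooth_curve \<gamma> \<and> \<gamma> ` {0..1} \<subseteq> usphere \<and> \<gamma> 0 = x \<and> \<gamma> 1 = flow t x}" for t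
  define len where "len = (finsler_length (randers_fun a b c) :: (real \<Rightarrow> complex ^ 'm) \<Rightarrow> real)"
  have dist: "finsler_dist (randers_fun a b c) x (flow t x) = Inf (len ` \<Gamma> t)" for t
    by (simp add: finsler_dist_def \<Gamma>_def len_def)
  have flow_in: "(\<lambda>\<tau>. flow (\<tau> * t) x) \<in> \<Gamma> t" for t
    using piecewise_smooth_flow x by (auto simp: \<Gamma>_def)
  define S where "S t = support x (X *v x) (flow t x - x)" for t
  have A0: "0 \<le> A" using randers_fun_nonneg[OF x] by (simp add: A_def)
  have len0: "0 \<le> len \<gamma>" and lenS: "S t \<le> len \<gamma> + lip * (len \<gamma> / lower)\<^sup>2" if "\<gamma> \<in> \<Gamma> t" for \<gamma> t
    using support_le_length(1)[of \<gamma> "len \<gamma>"] support_le_length(2)[of \<gamma> "len \<gamma>" "X *v x"] that by (auto simp: \<Gamma>_def len_def S_def)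
  have upper: "finsler_dist (randers_fun a b c) x (flow t x) \<le> t * A" if "0 < t" for t
  proof -
    have "Inf (len ` \<Gamma> t) \<le> len (\<lambda>\<tau>. flow (\<tau> * t) x)"
      using len0 flow_in by (intro cINF_lower bdd_belowI2[of _ 0]) auto
    also have "\<dots> = t * A" using that by (simp add: len_def finsler_length_flow A_def)
    finally show ?thesis by (simp add: dist)
  qed
  \<comment> \<open>The error term is controlled only for curves of length at most
    \<open>t * A\<close>; the minimum takes care of all longer ones.\<close>
  have low: "min (t * A) (S t - lip * (t * A / lower)\<^sup>2) \<le> finsler_dist (randers_fun a b c) x (flow t x)" if "0 < t" for t
    unfolding dist
  proof (rule cINF_greatest)
    show "\<Gamma> t \<noteq> {}" using flow_in by blast
    fix \<gamma> assume \<gamma>: "\<gamma> \<in> \<Gamma> t"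
    show "min (t * A) (S t - lip * (t * A / lower)\<^sup>2) \<le> len \<gamma>"
    proof (cases "len \<gamma> \<le> t * A")
      case True
      then have "(len \<gamma> / lower)\<^sup>2 \<le> (t * A / lower)\<^sup>2"
        using len0[OF \<gamma>] lower_pos by (intro power_mono divide_right_mono) auto
      then have "lip * (len \<gamma> / lower)\<^sup>2 \<le> lip * (t * A / lower)\<^sup>2"
        using lip_nonneg by (rule mult_left_mono)
      then show ?thesis using lenS[OF \<gamma>] by linarith
    qed auto
  qed
  have S_lim: "((\<lambda>t. S t / t) \<longlongrightarrow> A) (at_right 0)"
  proof -
    have "bounded_linear (support x (X *v x))"
      using linear_support by (simp add: linear_conv_bounded_linear)
    from bounded_linear.has_vector_derivative[OF this flow_has_vector_derivative[of x 0 UNIV]]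
    have "((\<lambda>t. support x (X *v x) (flow t x)) has_real_derivative A) (at 0)"
      by (simp add: has_real_derivative_iff_has_vector_derivative support_self[OF x] A_def)
    then have "((\<lambda>t. S t / t) \<longlongrightarrow> A) (at 0)"
      by (simp add: has_field_derivative_iff S_def linear_diff[OF linear_support])
    then show ?thesis by (rule tendsto_within_subset) simp
  qed
  have "((\<lambda>t. min A (S t / t - lip * (A / lower)\<^sup>2 * t)) \<longlongrightarrow> min A (A - lip * (A / lower)\<^sup>2 * 0)) (at_right 0)"
    by (intro tendsto_intros S_lim)
  then have "((\<lambda>t. min A (S t / t - lip * (A / lower)\<^sup>2 * t)) \<longlongrightarrow> A) (at_right 0)" by simp
  then have "((\<lambda>t. finsler_dist (randers_fun a b c) x (flow t x) / t) \<longlongrightarrow> A) (at_right 0)"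
  proof (rule tendsto_sandwich[rotated 2, OF _ tendsto_const[of A]])
    show "\<forall>\<^sub>F t in at_right 0. min A (S t / t - lip * (A / lower)\<^sup>2 * t) \<le> finsler_dist (randers_fun a b c) x (flow t x) / t"
      using eventually_at_right_less[of 0]
    proof eventually_elim
      case (elim t)
      have "min A (S t / t - lip * (A / lower)\<^sup>2 * t) = min (t * A) (S t - lip * (t * A / lower)\<^sup>2) / t"
        using elim by (auto simp: min_def field_simps power2_eq_square)
      also have "\<dots> \<le> finsler_dist (randers_fun a b c) x (flow t x) / t"
        using low[OF elim] elim by (intro divide_right_mono) auto
      finally show ?case .
    qed
    show "\<forall>\<^sub>F t in at_right 0. finsler_dist (randers_fun a b c) x (flow t x) / t \<le> A"
      using eventually_at_right_less[of 0]
      by eventually_elim (use upper in \<open>simp add: field_simps\<close>)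
  qed
  then show ?thesis by (simp add: A_def)
qed

section \<open>Uniqueness\<close>

lemma tsp_imult: "\<i> *s x \<in> tsp x" for x :: "complex ^ 'm"
  by (simp add: tsp_def)

text \<open>A unitary map fixing \<open>x\<close> and negating a vector Hermitian-orthogonal to \<open>x\<close> removes the terms odd in
  that vector.\<close>

lemma unitary_invariant_randers_form:
  fixes F :: "complex ^ 'm \<Rightarrow> complex ^ 'm \<Rightarrow> real" and x0 v0 :: "complex ^ 'm"
  assumes F: "nonriemannian_randers F" "unitary_invariant F"
    and x0: "norm x0 = 1" and v0: "norm v0 = 1" "x0 \<bullet> v0 = 0" "(\<i> *s x0) \<bullet> v0 = 0"
  obtains a b c where "randers_coefficients a b c"
    and "\<And>x v. x \<in> usphere \<Longrightarrow> v \<in> tsp x \<Longrightarrow> F x v = randers_fun a b c x v"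
proof -
  obtain g \<beta> where rm: "riemannian_metric g" and of: "smooth_one_form \<beta>"
    and cl: "\<And>x. x \<in> usphere \<Longrightarrow> covector_length g \<beta> x < 1"
    and Fgb: "\<And>x v. x \<in> usphere \<Longrightarrow> v \<in> tsp x \<Longrightarrow> F x v = sqrt (g x v v) + \<beta> x v"
    using F(1) unfolding nonriemannian_randers_def randers_pair_def by blast
  have tsp_lin: "r *\<^sub>R u + s *\<^sub>R v \<in> tsp x" if "u \<in> tsp x" "v \<in> tsp x" for r s u v and x :: "complex ^ 'm"
    using that by (simp add: tsp_def inner_add)
  have \<beta>_lin: "\<beta> x (r *\<^sub>R u + s *\<^sub>R v) = r * \<beta> x u + s * \<beta> x v"
    if "x \<in> usphere" "u \<in> tsp x" "v \<in> tsp x" for x u v r s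
    using of that unfolding smooth_one_form_def by blast
  have g_lin: "g x (r *\<^sub>R u + s *\<^sub>R v) w = r * g x u w + s * g x v w"
    and g_sym: "g x u v = g x v u"
    if "x \<in> usphere" "u \<in> tsp x" "v \<in> tsp x" "w \<in> tsp x" for x u v w r s
    using rm that unfolding riemannian_metric_def by blast+
  have g_pos: "0 < g x v v" if "x \<in> usphere" "v \<in> tsp x" "v \<noteq> 0" for x v
    using rm that unfolding riemannian_metric_def by blast
  have g_quad: "g x (r *\<^sub>R u + s *\<^sub>R v) (r *\<^sub>R u + s *\<^sub>R v)
      = r\<^sup>2 * g x u u + 2 * r * s * g x u v + s\<^sup>2 * g x v v"
    if "x \<in> usphere" "u \<in> tsp x" "v \<in> tsp x" for x u v r s
  proof -
    have w: "r *\<^sub>R u + s *\<^sub>R v \<in> tsp x" using tsp_lin that by blast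
    show ?thesis
      unfolding g_lin[OF that w] g_sym[OF that(1,2) w w] g_sym[OF that(1,3) w w]
        g_lin[OF that that(2)] g_lin[OF that that(3)]
      using g_sym[OF that that(2)] by (simp add: power2_eq_square algebra_simps)
  qed
  have tsp_minus: "- v \<in> tsp x" if "v \<in> tsp x" for v and x :: "complex ^ 'm"
    using that by (simp add: tsp_def)
  have \<beta>_minus: "\<beta> x (- v) = - \<beta> x v" and g_minus: "g x (- v) (- v) = g x v v"
    if "x \<in> usphere" "v \<in> tsp x" for x v
    using \<beta>_lin[OF that that(2), of "-1" 0] g_quad[OF that that(2), of "-1" 0] by simp_all
  have g_nonneg: "0 \<le> g x v v" if "x \<in> usphere" "v \<in> tsp x" for x v
    using g_pos[OF that] g_quad[OF that that(2), of 0 0] by (cases "v = 0") auto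
  \<comment> \<open>Invariance is assumed for \<open>F\<close> only. Comparing its values at
    \<open>v\<close> and \<open>- v\<close> separates the even part \<open>sqrt g\<close> from the
    odd part \<open>\<beta>\<close>, so each is invariant.\<close>
  have inv: "\<beta> (U *v x) (U *v v) = \<beta> x v" "g (U *v x) (U *v v) (U *v v) = g x v v"
    if U: "unitary U" and x: "x \<in> usphere" and v: "v \<in> tsp x" for U x v
  proof -
    have Ux: "U *v x \<in> usphere" using x unitary_norm[OF U] by simp
    have Uv: "U *v v \<in> tsp (U *v x)" using v unitary_inner[OF U] by (simp add: tsp_def)
    have "F (U *v x) (U *v v) = F x v" "F (U *v x) (U *v (- v)) = F x (- v)"
      using F(2) U x v tsp_minus unfolding unitary_invariant_def by blast+
    moreover have "U *v (- v) = - (U *v v)"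
      by (rule linear_neg[OF bounded_linear.linear[OF bounded_linear_matrix_vector]])
    ultimately have "sqrt (g (U *v x) (U *v v) (U *v v)) + \<beta> (U *v x) (U *v v) = sqrt (g x v v) + \<beta> x v"
      "sqrt (g (U *v x) (U *v v) (U *v v)) - \<beta> (U *v x) (U *v v) = sqrt (g x v v) - \<beta> x v"
      using Fgb[OF x v] Fgb[OF x tsp_minus[OF v]] Fgb[OF Ux Uv] Fgb[OF Ux tsp_minus[OF Uv]]
        \<beta>_minus[OF x v] \<beta>_minus[OF Ux Uv] g_minus[OF x v] g_minus[OF Ux Uv] by simp_all
    then have "\<beta> (U *v x) (U *v v) = \<beta> x v \<and> sqrt (g (U *v x) (U *v v) (U *v v)) = sqrt (g x v v)"
      by linarith
    then show "\<beta> (U *v x) (U *v v) = \<beta> x v" "g (U *v x) (U *v v) (U *v v) = g x v v" by simp_all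
  qed
  define a q c where "a = g x0 v0 v0" and "q = g x0 (\<i> *s x0) (\<i> *s x0)" and "c = \<beta> x0 (\<i> *s x0)"
  have x0': "x0 \<in> usphere" and v0': "v0 \<in> tsp x0" using x0 v0 by (simp_all add: tsp_def)
  have form: "\<beta> x v = c * ((\<i> *s x) \<bullet> v)"
    "g x v v = a * (v \<bullet> v - ((\<i> *s x) \<bullet> v)\<^sup>2) + q * ((\<i> *s x) \<bullet> v)\<^sup>2"
    if x: "x \<in> usphere" and v: "v \<in> tsp x" for x v
  proof -
    have nx: "norm x = 1" "x \<bullet> x = 1" using x by (simp_all add: norm_eq_1)
    define s where "s = (\<i> *s x) \<bullet> v"
    define h where "h = v - s *\<^sub>R (\<i> *s x)"
    have h: "x \<bullet> h = 0" "(\<i> *s x) \<bullet> h = 0"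
      using v nx by (simp_all add: h_def tsp_def inner_diff s_def)
    then have ht: "h \<in> tsp x" by (simp add: tsp_def)
    have vs: "v \<bullet> (\<i> *s x) = s" by (simp add: s_def inner_commute)
    have hh: "h \<bullet> h = v \<bullet> v - s\<^sup>2"
      using nx by (simp add: h_def inner_diff s_def[symmetric] vs power2_eq_square)
    obtain U where U: "unitary U" "U *v x = x" "U *v h = - h"
      using unitary_transitive_frames[of x x h "- h"] h by auto
    \<comment> \<open>\<open>V\<close> transports the reference frame to \<open>x\<close> and
      \<open>h\<close>, so the three numbers read off at \<open>x0\<close> serve at every
      point.\<close>
    obtain V where V: "unitary V" "V *v x0 = x" "V *v (norm h *\<^sub>R v0) = h"
      using unitary_transitive_frames[of x0 x "norm h *\<^sub>R v0" h] h v0 x0 nx by auto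
    have \<beta>h: "\<beta> x h = 0" using inv(1)[OF U(1) x ht] \<beta>_minus[OF x ht] U by simp
    have \<beta>i: "\<beta> x (\<i> *s x) = c"
      using inv(1)[OF V(1) x0' tsp_imult] V by (simp add: c_def matrix_vector_imult)
    have gi: "g x (\<i> *s x) (\<i> *s x) = q"
      using inv(2)[OF V(1) x0' tsp_imult] V by (simp add: q_def matrix_vector_imult)
    have "norm h *\<^sub>R v0 \<in> tsp x0" using v0' by (simp add: tsp_def)
    from inv(2)[OF V(1) x0' this] have gh: "g x h h = (h \<bullet> h) * a"
      using g_quad[OF x0' v0' v0', of "norm h" 0] V by (simp add: a_def power2_norm_eq_inner)
    have v_split: "v = 1 *\<^sub>R h + s *\<^sub>R (\<i> *s x)" by (simp add: h_def)
    show "\<beta> x v = c * ((\<i> *s x) \<bullet> v)"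
      using \<beta>_lin[OF x ht tsp_imult, of 1 s] unfolding v_split[symmetric] \<beta>h \<beta>i by (simp add: s_def)
    have "U *v v = (-1) *\<^sub>R h + s *\<^sub>R (\<i> *s x)"
    proof -
      have "U *v v = U *v h + s *\<^sub>R (U *v (\<i> *s x))"
        by (subst v_split) (simp add: linear_add linear_cmul bounded_linear.linear[OF bounded_linear_matrix_vector])
      then show ?thesis using U by (simp add: matrix_vector_imult)
    qed
    with inv(2)[OF U(1) x v] U
    have "g x v v = g x ((-1) *\<^sub>R h + s *\<^sub>R (\<i> *s x)) ((-1) *\<^sub>R h + s *\<^sub>R (\<i> *s x))" by simp
    then have "2 * g x v v = 2 * g x h h + 2 * (s\<^sup>2 * q)"
      using g_quad[OF x ht tsp_imult, of "-1" s] g_quad[OF x ht tsp_imult, of 1 s]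
      unfolding v_split[symmetric] gi by simp
    then show "g x v v = a * (v \<bullet> v - ((\<i> *s x) \<bullet> v)\<^sup>2) + q * ((\<i> *s x) \<bullet> v)\<^sup>2"
      unfolding gh hh s_def[symmetric] by (simp add: algebra_simps)
  qed
  have "v0 \<noteq> 0" using v0 by auto
  then have a0: "0 < a" unfolding a_def by (rule g_pos[OF x0' v0'])
  have "\<i> *s x0 \<noteq> 0" using x0 norm_smult[of \<i> x0] by auto
  then have q0: "0 < q" unfolding q_def by (rule g_pos[OF x0' tsp_imult])
  \<comment> \<open>The vector of \<open>g\<close>-length 1 along the Hopf field, on which the
    one-form attains its dual norm \<open>\<bar>c\<bar> / sqrt q\<close>. The supremum bounds this
    value only after boundedness has been shown.\<close>
  define w where "w = (1 / sqrt q) *\<^sub>R (\<i> *s x0)"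
  have sw: "(\<i> *s x0) \<bullet> w = 1 / sqrt q" using x0 by (simp add: w_def norm_eq_1)
  have ww: "w \<bullet> w = 1 / q" using x0 q0 by (simp add: w_def norm_eq_1)
  have w: "w \<in> tsp x0" by (simp add: w_def tsp_def)
  have "\<bar>\<beta> x0 w\<bar> \<le> covector_length g \<beta> x0"
    unfolding covector_length_def
  proof (rule cSUP_upper)
    show "w \<in> {v \<in> tsp x0. g x0 v v \<le> 1}"
      using w q0 unfolding mem_Collect_eq form(2)[OF x0' w] sw ww by (simp add: power_divide)
    have "\<bar>\<beta> x0 v\<bar> \<le> \<bar>c\<bar> * (1 / sqrt q)" if v: "v \<in> tsp x0" "g x0 v v \<le> 1" for v
    proof -
      have "0 \<le> a * (v \<bullet> v - ((\<i> *s x0) \<bullet> v)\<^sup>2)" using inner_imult_bound[OF x0, of v] a0 by simp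
      then have "((\<i> *s x0) \<bullet> v)\<^sup>2 * q \<le> 1" using v(2) form(2)[OF x0' v(1)] by (simp add: mult.commute)
      then have "((\<i> *s x0) \<bullet> v)\<^sup>2 \<le> 1 / q" using q0 by (simp add: field_simps)
      then have "\<bar>(\<i> *s x0) \<bullet> v\<bar> \<le> 1 / sqrt q"
        using real_sqrt_le_mono[of "((\<i> *s x0) \<bullet> v)\<^sup>2" "1 / q"] by (simp add: real_sqrt_divide)
      then have "\<bar>c\<bar> * \<bar>(\<i> *s x0) \<bullet> v\<bar> \<le> \<bar>c\<bar> * (1 / sqrt q)" by (rule mult_left_mono) simp
      then show ?thesis unfolding form(1)[OF x0' v(1)] abs_mult .
    qed
    then show "bdd_above ((\<lambda>v. \<bar>\<beta> x0 v\<bar>) ` {v \<in> tsp x0. g x0 v v \<le> 1})"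
      by (intro bdd_aboveI2) auto
  qed
  also have "\<dots> < 1" by (rule cl[OF x0'])
  finally have "\<bar>c\<bar> < sqrt q" unfolding form(1)[OF x0' w] sw using q0 by (simp add: abs_mult)
  then have "randers_coefficients a (q - a) c" using a0 by unfold_locales simp_all
  moreover have "F x v = randers_fun a (q - a) c x v" if "x \<in> usphere" "v \<in> tsp x" for x v
    unfolding Fgb[OF that] form[OF that] randers_fun_def by (simp add: algebra_simps)
  ultimately show ?thesis by (rule that)
qed

lemma quadratic_three_roots:
  fixes p q r :: real
  assumes "p * x\<^sup>2 + q * x + r = 0" "p * y\<^sup>2 + q * y + r = 0" "p * z\<^sup>2 + q * z + r = 0"
    and "x \<noteq> y" "x \<noteq> z" "y \<noteq> z"
  shows "p = 0" "q = 0" "r = 0"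
proof -
  have "(x - y) * (p * (x + y) + q) = 0" "(x - z) * (p * (x + z) + q) = 0"
    using assms(1-3) by (simp_all add: power2_eq_square algebra_simps)
  then have xy: "p * (x + y) + q = 0" "p * (x + z) + q = 0" using assms(4,5) by simp_all
  moreover have "p * (y - z) = (p * (x + y) + q) - (p * (x + z) + q)" by (simp add: algebra_simps)
  ultimately have "p * (y - z) = 0" by simp
  then show "p = 0" using assms(6) by simp
  with xy show "q = 0" by simp
  with \<open>p = 0\<close> assms(1) show "r = 0" by simp
qed

section \<open>Determining the coefficients of a competing metric\<close>

context opposite_signs begin

lemma CW_constant_length:
  assumes abc: "randers_coefficients a b c'"
    and F: "\<And>x v. x \<in> usphere \<Longrightarrow> v \<in> tsp x \<Longrightarrow> F x v = randers_fun a b c' x v"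
    and CW: "generates_CW_translations F X"
    and x: "norm x = 1" and y: "norm y = 1"
  shows "randers_fun a b c' x (X *v x) = randers_fun a b c' y (X *v y)"
proof (rule tendsto_unique[OF trivial_limit_at_right_real tendsto_finsler_dist_flow[OF abc x]])
  have "\<forall>\<^sub>F t in at_right 0. finsler_dist (randers_fun a b c') x (flow t x) / t
      = finsler_dist (randers_fun a b c') y (flow t y) / t"
    using CW unfolding generates_CW_translations_def
  proof eventually_elim
    case (elim t)
    then obtain r where "\<forall>x\<in>usphere. finsler_dist F x (flow t x) = r"
      unfolding CW_translation_def matrix_exp_flow by blast
    moreover have "finsler_dist F z w = finsler_dist (randers_fun a b c') z w" for z w
      by (rule finsler_dist_cong[OF F])
    ultimately show ?case using x y by simp
  qed
  with tendsto_finsler_dist_flow[OF abc y]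
  show "((\<lambda>t. finsler_dist (randers_fun a b c') x (flow t x) / t) \<longlongrightarrow> randers_fun a b c' y (X *v y)) (at_right 0)"
    using tendsto_cong by fast
qed

text \<open>Squaring the equation of constant length \<open>K\<close> gives a quadratic polynomial
  in \<open>s\<close> with three roots, so its coefficients vanish: \<open>b = c'\<^sup>2\<close>,
  \<open>K = sqrt a * k\<close>, \<open>c' = sqrt a * c\<close>. Only the scale \<open>a\<close>
  stays free.\<close>

lemma constant_length_unique:
  assumes "randers_coefficients a b c'"
    and const: "\<And>x y :: complex ^ 'm. norm x = 1 \<Longrightarrow> norm y = 1 \<Longrightarrow>
      randers_fun a b c' x (X *v x) = randers_fun a b c' y (X *v y)"
    and z1: "norm z1 = 1" "X *v z1 = \<mu>1 *\<^sub>R (\<i> *s z1)"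
    and z2: "norm z2 = 1" "X *v z2 = \<mu>2 *\<^sub>R (\<i> *s z2)"
  shows "randers_fun a b c' x v = sqrt a * randers_fun 1 (c\<^sup>2) c x v"
proof -
  interpret R: randers_coefficients a b c' by fact
  define K where "K = randers_fun a b c' z1 (X *v z1)"
  have Xz1: "X *v z1 \<noteq> 0"
    using z1 opposite norm_smult[of \<i> z1] by auto
  then have "0 < K"
    using R.randers_fun_lower[OF z1(1), of "X *v z1"] R.lower_pos
    unfolding K_def by (meson less_le_trans mult_pos_pos zero_less_norm_iff)
  have eq: "(b - c'\<^sup>2) * s\<^sup>2 + (a * (\<mu>1 + \<mu>2) + 2 * K * c') * s + (- a * (\<mu>1 * \<mu>2) - K\<^sup>2) = 0"
    if z: "norm z = 1" "(\<i> *s z) \<bullet> (X *v z) = s" for z s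
  proof -
    have "K = norm (R.embed z (X *v z)) + c' * s"
      unfolding K_def const[OF z1(1) z(1)] R.randers_fun_embed[OF z(1)] z(2) ..
    then have "(K - c' * s)\<^sup>2 = (norm (R.embed z (X *v z)))\<^sup>2" by simp
    then show ?thesis
      unfolding R.norm_embed_squared[OF z(1)] inner_X_X[OF z(1)] z(2)
      by (simp add: power2_eq_square algebra_simps)
  qed
  have s1: "(\<i> *s z1) \<bullet> (X *v z1) = \<mu>1" "(\<i> *s z2) \<bullet> (X *v z2) = \<mu>2"
    using z1 z2 by (simp_all add: norm_eq_1)
  have orth: "z1 \<bullet> z2 = 0" "z2 \<bullet> z1 = 0"
    using eigenvectors_orthogonal(1)[OF skew neq z1(2) z2(2)] by (simp_all add: inner_commute)
  \<comment> \<open>Orthogonality of the eigenvectors makes \<open>s\<close> the mean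
    \<open>m\<close> at this point, a third root different from \<open>\<mu>1\<close> and
    \<open>\<mu>2\<close>.\<close>
  define z where "z = (1 / sqrt 2) *\<^sub>R (z1 + z2)"
  have "z \<bullet> z = 1"
    using z1 z2 orth by (simp add: z_def inner_add norm_eq_1)
  then have nz: "norm z = 1" by (simp add: norm_eq_1)
  have "(\<i> *s z) \<bullet> (X *v z) = m"
    using z1 z2 orth by (simp add: z_def lin inner_add norm_eq_1 m_def add_divide_distrib)
  note three = quadratic_three_roots[OF eq[OF z1(1) s1(1)] eq[OF z2(1) s1(2)] eq[OF nz this] neq]
  have m: "\<mu>1 \<noteq> m" "\<mu>2 \<noteq> m" using neq by (auto simp: m_def)
  have b: "b = c'\<^sup>2" using three(1)[OF m] by simp
  have c': "2 * K * c' = - (2 * a * m)" using three(2)[OF m] by (simp add: m_def)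
  have "K\<^sup>2 = a * k\<^sup>2" using three(3)[OF m] unfolding k_squared by simp
  then have "K\<^sup>2 = (sqrt a * k)\<^sup>2" unfolding power_mult_distrib using R.a_pos by simp
  then have K: "K = sqrt a * k"
    by (rule power2_eq_imp_eq) (use \<open>0 < K\<close> k_pos R.a_pos in simp_all)
  have "sqrt a * (k * c') = - (a * m)" using c' unfolding K by (simp add: ac_simps)
  also have "\<dots> = sqrt a * sqrt a * (c * k)" using R.a_pos by (simp add: c_k)
  finally have "sqrt a * (k * c') = sqrt a * (k * (sqrt a * c))" by (simp only: ac_simps)
  then have "k * c' = k * (sqrt a * c)"
    by (rule mult_left_cancel[THEN iffD1, rotated]) (use R.a_pos in simp)
  then have "c' = sqrt a * c" using k_pos by simp
  moreover from this b have "b = a * c\<^sup>2" using R.a_pos by (simp add: power_mult_distrib)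
  ultimately show ?thesis
    using R.a_pos
    by (simp add: randers_fun_def distrib_left real_sqrt_mult[symmetric] algebra_simps)
qed

end

theorem theorem5p1:
  fixes n :: nat and X :: "complex ^ 'm ^ 'm" and \<mu>1 \<mu>2 :: real
  assumes "n \<ge> 1" and "CARD('m) = n + 1"
    and "skew_hermitian X"
    and "eigenvalues X = {\<i> * complex_of_real \<mu>1, \<i> * complex_of_real \<mu>2}"
    and "\<mu>1 \<noteq> \<mu>2" and "\<mu>1 * \<mu>2 < 0" and "\<bar>\<mu>1\<bar> \<noteq> \<bar>\<mu>2\<bar>"
  shows "\<exists>F. (nonriemannian_randers F \<and> unitary_invariant F \<and> generates_CW_translations F X) \<and>
     (\<forall>F'. nonriemannian_randers F' \<and> unitary_invariant F' \<and> generates_CW_translations F' X \<longrightarrow>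
        (\<exists>c>0. \<forall>x\<in>usphere. \<forall>v\<in>tsp x. F' x v = c * F x v))"
proof -
  interpret opposite_signs X \<mu>1 \<mu>2
    using skew_hermitian_two_eigenvalues[OF assms(3), of \<mu>1 \<mu>2] assms by unfold_locales simp_all
  have eigen: "\<exists>z. norm z = 1 \<and> X *v z = \<mu> *\<^sub>R (\<i> *s z)" if "\<i> * complex_of_real \<mu> \<in> eigenvalues X" for \<mu>
  proof -
    obtain v where v: "v \<noteq> 0" "X *v v = (\<i> * complex_of_real \<mu>) *s v"
      using \<open>\<i> * complex_of_real \<mu> \<in> eigenvalues X\<close> unfolding eigenvalues_def by blast
    then have "X *v v = \<mu> *\<^sub>R (\<i> *s v)" by (simp add: scaleR_eq_smult mult.commute)
    then have "X *v ((1 / norm v) *\<^sub>R v) = \<mu> *\<^sub>R (\<i> *s ((1 / norm v) *\<^sub>R v))"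
      by (simp add: lin mult.commute)
    moreover have "norm ((1 / norm v) *\<^sub>R v) = 1" using v by simp
    ultimately show ?thesis by blast
  qed
  obtain z1 z2 where z1: "norm z1 = 1" "X *v z1 = \<mu>1 *\<^sub>R (\<i> *s z1)"
    and z2: "norm z2 = 1" "X *v z2 = \<mu>2 *\<^sub>R (\<i> *s z2)"
    using eigen[of \<mu>1] eigen[of \<mu>2] assms(4) by auto
  \<comment> \<open>The two eigenvectors also form the Hermitian-orthonormal pair at which the
    coefficients of \<open>F'\<close> are read off.\<close>
  note orth = eigenvectors_orthogonal[OF skew neq z1(2) z2(2)]
  let ?F = "randers_fun 1 (c\<^sup>2) c :: complex ^ 'm \<Rightarrow> complex ^ 'm \<Rightarrow> real"
  have "\<exists>r>0. \<forall>x\<in>usphere. \<forall>v\<in>tsp x. F' x v = r * ?F x v"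
    if F': "nonriemannian_randers F'" "unitary_invariant F'" and CW: "generates_CW_translations F' X" for F'
  proof -
    obtain a b c' where abc: "randers_coefficients a b c'"
      and eq: "\<And>x v. x \<in> usphere \<Longrightarrow> v \<in> tsp x \<Longrightarrow> F' x v = randers_fun a b c' x v"
      using unitary_invariant_randers_form[OF F' z1(1) z2(1) orth] by metis
    have "randers_fun a b c' x v = sqrt a * ?F x v" for x v
      by (rule constant_length_unique[OF abc CW_constant_length[OF abc eq CW] z1 z2])
    moreover have "0 < sqrt a" using randers_coefficients.a_pos[OF abc] by simp
    ultimately show ?thesis using eq by (intro exI[of _ "sqrt a"]) simp
  qed
  moreover have "\<mu>1 + \<mu>2 \<noteq> 0" using assms(7) by auto
  ultimately show ?thesis
    using nonriemannian_randers unitary_invariant_randers_fun generates_CW_translations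
    by (intro exI[of _ ?F]) blast
qed

end
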